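(* There is a deterministic prediction-based online algorithm for online matching on the line which, against any offline algorithm $\textsc{Off}$, attains competitive ratio \[O\left(\min\left\{\log n,\;1+\frac{\eta}{\textsc{Off}}\right\}\right),\] where $n$ is the number of servers (and requests), $\eta$ is the prediction error with respect to $\textsc{Off}$, and $\textsc{Off}$ also denotes the cost of that offline algorithm.
   Context: Online matching on the line: a set $S=\{s_1,\dots,s_n\}$ of server locations on the real line is given. Requests $r_1,\dots,r_n$ (points on the real line) arrive one at a time; upon arrival $r_i$ must be irrevocably matched to a previously unmatched server $s_j$ at cost $|s_j-r_i|$. The objective is to minimize the total cost of the final perfect matching. The configuration of an algorithm after $i$ requests is the set of servers matched so far. For two sets $X,Y$ of $i$ points each, $\mathit{dist}(X,Y)$ is the cost of a minimum-cost perfect matching between $X$ and $Y$. In the prediction setting, in round $i$ together with $r_i$ the algorithm receives a predicted configuration $P_i\subseteq S$ with $|P_i|=i$ (possibly $P_i\not\subseteq P_{i+1}$). For an offline algorithm $\textsc{Off}$ with configuration $\textsc{Off}_i$ after $i$ requests, the error is $\eta=\sum_{i=1}^n\mathit{dist}(P_i,\textsc{Off}_i)$. Competitive ratio $r$ against $\textsc{Off}$ means cost at most $r\cdot\textsc{Off}$ plus a constant independent of the input. *)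

theory Defs
  imports Complex_Main "HOL-Library.FuncSet"
begin

definition matching_dist :: "real set \<Rightarrow> real set \<Rightarrow> real" where
  "matching_dist X Y =
     Min ((\<lambda>f. \<Sum>x\<in>X. \<bar>x - f x\<bar>) ` {f \<in> X \<rightarrow>\<^sub>E Y. bij_betw f X Y})"

lemma matching_dist_attained:
  assumes "finite X" "finite Y" "card X = card Y"
  shows "\<exists>f. bij_betw f X Y \<and> matching_dist X Y = (\<Sum>x\<in>X. \<bar>x - f x\<bar>)"
proof -
  let ?F = "{f \<in> X \<rightarrow>\<^sub>E Y. bij_betw f X Y}"
  have fin: "finite ?F"
    using assms by (simp add: finite_PiE)
  obtain g where g: "bij_betw g X Y"
    using assms finite_same_card_bij by blast
  have "bij_betw (restrict g X) X Y"
    using g by (simp cong: bij_betw_cong)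
  moreover have "restrict g X \<in> X \<rightarrow>\<^sub>E Y"
    using g by (auto simp: bij_betw_def)
  ultimately have "?F \<noteq> {}" by blast
  with fin have "matching_dist X Y \<in> (\<lambda>f. \<Sum>x\<in>X. \<bar>x - f x\<bar>) ` ?F"
    unfolding matching_dist_def by (intro Min_in) auto
  then show ?thesis by auto
qed

text \<open>
  Rounds are numbered from 0, so \<open>Ps ! i\<close> is the configuration predicted together with request
  \<open>rs ! i\<close> and has \<open>i + 1\<close> elements.  Consecutive predictions need not be nested.
\<close>

definition valid_requests :: "real set \<Rightarrow> real list \<Rightarrow> bool" where
  "valid_requests S rs \<longleftrightarrow> finite S \<and> length rs = card S"

definition valid_predictions :: "real set \<Rightarrow> real set list \<Rightarrow> bool" where
  "valid_predictions S Ps \<longleftrightarrow>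
     length Ps = card S \<and> (\<forall>i < card S. Ps ! i \<subseteq> S \<and> card (Ps ! i) = Suc i)"

text \<open>
  A solution is the list of servers in the order of the requests they are matched to.
\<close>

definition perfect_matching :: "real set \<Rightarrow> real list \<Rightarrow> bool" where
  "perfect_matching S ms \<longleftrightarrow> distinct ms \<and> set ms = S"

definition matching_cost :: "real list \<Rightarrow> real list \<Rightarrow> real" where
  "matching_cost rs ms = (\<Sum>i < length rs. \<bar>ms ! i - rs ! i\<bar>)"

definition configuration :: "real list \<Rightarrow> nat \<Rightarrow> real set" where
  "configuration ms i = set (take i ms)"

definition prediction_error :: "real set list \<Rightarrow> real list \<Rightarrow> real" where
  "prediction_error Ps ms =
     (\<Sum>i < length Ps. matching_dist (Ps ! i) (configuration ms (Suc i)))"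

text \<open>
  A deterministic online algorithm maps the server set and the requests and predictions revealed
  so far, including those of the current round, to the server for the current request.  Its own
  earlier choices are determined by the prefixes of this history.  As every legal history extends
  to a complete legal input, it suffices to demand legal choices on complete inputs.
\<close>

type_synonym online_alg = "real set \<Rightarrow> (real \<times> real set) list \<Rightarrow> real"

definition online_matching :: "online_alg \<Rightarrow> real set \<Rightarrow> real list \<Rightarrow> real set list \<Rightarrow> real list" where
  "online_matching A S rs Ps = map (\<lambda>i. A S (take (Suc i) (zip rs Ps))) [0..<length rs]"

definition online_algorithm :: "online_alg \<Rightarrow> bool" where
  "online_algorithm A \<longleftrightarrow>
     (\<forall>S rs Ps. valid_requests S rs \<and> valid_predictions S Ps \<longrightarrow>
        perfect_matching S (online_matching A S rs Ps))"

type_synonym offline_alg = "real set \<Rightarrow> real list \<Rightarrow> real list"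

definition offline_algorithm :: "offline_alg \<Rightarrow> bool" where
  "offline_algorithm Off \<longleftrightarrow>
     (\<forall>S rs. valid_requests S rs \<longrightarrow> perfect_matching S (Off S rs))"

end

theory Submission
  imports Defs
begin

text \<open>
  By an augmenting path argument, an online algorithm can follow any sequence of configurations
  at the cost of the cheapest changes between them. Hence two algorithms can be combined by
  switching between their configurations whenever one gets twice as expensive as the other.
  Following the predictions costs at most \<open>off + 2 * \<eta>\<close> by the triangle
  inequality.

  It remains to find an \<open>O(log n)\<close>-competitive algorithm. Round the requests to
  their nearest servers and match each of them to one of the two adjacent free servers, the one
  with the smaller net cost, where new flow along the line costs 2 per unit of length and
  cancelled flow refunds 1. Then no path to a free server ever has negative net cost, and the
  total cost is at most 4 times the sum of the distances from the requests to the nearest free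
  servers at their arrival. By stability and the rising sun lemma, the supremum over time of the
  flow across a gap, summed over all gaps, is at most 12 times the offline cost. If a request
  has no free server within distance \<open>x\<close>, then all servers near it are used, so
  that further requests nearby must change the flow on a stretch of length proportional to
  \<open>x\<close>. Hence the number of such requests is \<open>O(off / x)\<close>, the
  \<open>k\<close>-th largest of these distances is \<open>O(off / k)\<close>, and summing up
  gives the harmonic number.
\<close>

section \<open>Following and combining sequences of configurations\<close>

lemma matching_dist_le:
  assumes "finite X" "bij_betw f X Y"
  shows "matching_dist X Y \<le> (\<Sum>x\<in>X. \<bar>x - f x\<bar>)"
proof -
  let ?F = "{f \<in> X \<rightarrow>\<^sub>E Y. bij_betw f X Y}"
  have "finite Y" using assms bij_betw_finite by blast
  then have fin: "finite ?F" using assms by (simp add: finite_PiE)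
  have "restrict f X \<in> ?F"
    using assms(2) by (auto simp: bij_betw_def cong: bij_betw_cong)
  then have "matching_dist X Y \<le> (\<Sum>x\<in>X. \<bar>x - restrict f X x\<bar>)"
    unfolding matching_dist_def using fin by (intro Min_le finite_imageI imageI)
  then show ?thesis by simp
qed

lemma matching_dist_nonneg:
  assumes "finite X" "finite Y" "card X = card Y"
  shows "0 \<le> matching_dist X Y"
  using matching_dist_attained[OF assms] by (auto intro: sum_nonneg)

lemma matching_dist_self_le: "finite X \<Longrightarrow> matching_dist X X \<le> 0"
  using matching_dist_le[of X id X] by simp

lemma matching_dist_commute_le:
  assumes "finite X" "finite Y" "card X = card Y"
  shows "matching_dist Y X \<le> matching_dist X Y"
proof -
  obtain f where f: "bij_betw f X Y" "matching_dist X Y = (\<Sum>x\<in>X. \<bar>x - f x\<bar>)"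
    using matching_dist_attained[OF assms] by blast
  let ?g = "inv_into X f"
  have "matching_dist Y X \<le> (\<Sum>y\<in>Y. \<bar>y - ?g y\<bar>)"
    using f(1) assms by (intro matching_dist_le bij_betw_inv_into) auto
  also have "\<dots> = (\<Sum>x\<in>X. \<bar>f x - ?g (f x)\<bar>)"
    using f(1) by (simp add: sum.reindex_bij_betw[symmetric])
  also have "\<dots> = (\<Sum>x\<in>X. \<bar>x - f x\<bar>)"
    using f(1) by (intro sum.cong) (auto simp: bij_betw_inv_into_left)
  finally show ?thesis using f(2) by simp
qed

lemma matching_dist_triangle:
  assumes "finite X" "finite Y" "finite Z" "card X = card Y" "card Y = card Z"
  shows "matching_dist X Z \<le> matching_dist X Y + matching_dist Y Z"
proof -
  obtain f where f: "bij_betw f X Y" "matching_dist X Y = (\<Sum>x\<in>X. \<bar>x - f x\<bar>)"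
    using matching_dist_attained assms by metis
  obtain g where g: "bij_betw g Y Z" "matching_dist Y Z = (\<Sum>x\<in>Y. \<bar>x - g x\<bar>)"
    using matching_dist_attained assms by metis
  have "matching_dist X Z \<le> (\<Sum>x\<in>X. \<bar>x - (g \<circ> f) x\<bar>)"
    using f g assms by (intro matching_dist_le bij_betw_trans)
  also have "\<dots> \<le> (\<Sum>x\<in>X. \<bar>x - f x\<bar> + \<bar>f x - g (f x)\<bar>)"
    by (intro sum_mono) auto
  also have "\<dots> = matching_dist X Y + matching_dist Y Z"
    using f g by (simp add: sum.distrib sum.reindex_bij_betw[OF f(1), of "\<lambda>y. \<bar>y - g y\<bar>"])
  finally show ?thesis .
qed

lemma matching_dist_insert_le:
  assumes "finite X" "finite Y" "card X = card Y" "x \<notin> X" "y \<notin> Y"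
  shows "matching_dist (insert x X) (insert y Y) \<le> \<bar>x - y\<bar> + matching_dist X Y"
proof -
  obtain f where f: "bij_betw f X Y" "matching_dist X Y = (\<Sum>x\<in>X. \<bar>x - f x\<bar>)"
    using matching_dist_attained assms by metis
  have "bij_betw (f(x := y)) X Y"
    using f(1) assms(4) by (subst bij_betw_cong[where g = f]) auto
  then have "bij_betw (f(x := y)) (insert x X) (insert y Y)"
    using assms by (intro bij_betw_combine[where A = "{x}" and C = X and B = "{y}" and D = Y, simplified])
      (auto simp: bij_betw_def)
  then have "matching_dist (insert x X) (insert y Y) \<le> (\<Sum>z\<in>insert x X. \<bar>z - (f(x := y)) z\<bar>)"
    using assms by (intro matching_dist_le) (auto simp del: fun_upd_apply)
  also have "\<dots> = \<bar>x - y\<bar> + (\<Sum>z\<in>X. \<bar>z - (f(x := y)) z\<bar>)"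
    using assms by simp
  also have "(\<Sum>z\<in>X. \<bar>z - (f(x := y)) z\<bar>) = matching_dist X Y"
    using assms f by (auto intro: sum.cong)
  finally show ?thesis .
qed

text \<open>This is the matching distance between \<open>U\<close> with \<open>r\<close> added and
  \<open>X\<close>. The request is split off because it may coincide with a point of
  \<open>U\<close>, so that the union would lose a point.\<close>

definition serve_cost :: "real set \<Rightarrow> real \<Rightarrow> real set \<Rightarrow> real" where
  "serve_cost U r X = Min ((\<lambda>x. \<bar>r - x\<bar> + matching_dist U (X - {x})) ` X)"

lemma serve_cost_le:
  "finite X \<Longrightarrow> x \<in> X \<Longrightarrow> serve_cost U r X \<le> \<bar>r - x\<bar> + matching_dist U (X - {x})"
  unfolding serve_cost_def by (intro Min_le) auto

lemma serve_cost_attained: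
  assumes "card X = Suc m"
  obtains x where "x \<in> X" "serve_cost U r X = \<bar>r - x\<bar> + matching_dist U (X - {x})"
proof -
  have "finite X" "X \<noteq> {}" using assms card.infinite by force+
  then have "serve_cost U r X \<in> (\<lambda>x. \<bar>r - x\<bar> + matching_dist U (X - {x})) ` X"
    unfolding serve_cost_def by (intro Min_in) auto
  then show ?thesis using that by blast
qed

lemma serve_cost_triangle:
  assumes "finite U" "finite V" "card U = card V" "card X = Suc (card V)"
  shows "serve_cost U r X \<le> matching_dist U V + serve_cost V r X"
proof -
  obtain x where x: "x \<in> X" "serve_cost V r X = \<bar>r - x\<bar> + matching_dist V (X - {x})"
    using serve_cost_attained assms by metis
  have fX: "finite X" using assms card.infinite by force
  have "matching_dist U (X - {x}) \<le> matching_dist U V + matching_dist V (X - {x})"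
    using assms fX x by (intro matching_dist_triangle) auto
  with serve_cost_le[OF fX x(1), of U r] x(2) show ?thesis by simp
qed

lemma serve_cost_nonneg:
  assumes "finite U" "card X = Suc (card U)"
  shows "0 \<le> serve_cost U r X"
proof -
  obtain x where x: "x \<in> X" "serve_cost U r X = \<bar>r - x\<bar> + matching_dist U (X - {x})"
    using serve_cost_attained assms by metis
  have fX: "finite X" using assms card.infinite by force
  show ?thesis using x fX assms matching_dist_nonneg[of U "X - {x}"] by simp
qed

text \<open>Go from \<open>A'\<close> back to \<open>A\<close> together with \<open>r\<close>, on to
  \<open>B\<close> together with \<open>r\<close>, and then to \<open>B'\<close>. The partners
  \<open>a\<close> and \<open>b\<close> of \<open>r\<close> get matched to each other through
  \<open>r\<close>.\<close>

lemma matching_dist_serve: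
  assumes "finite A" "finite B" "card A = card B" "card A' = Suc (card A)" "card B' = Suc (card B)"
  shows "matching_dist A' B' \<le> matching_dist A B + serve_cost A r A' + serve_cost B r B'"
proof -
  have fin: "finite A'" "finite B'" using assms card.infinite by force+
  obtain a where a: "a \<in> A'" "serve_cost A r A' = \<bar>r - a\<bar> + matching_dist A (A' - {a})"
    using serve_cost_attained assms by metis
  obtain b where b: "b \<in> B'" "serve_cost B r B' = \<bar>r - b\<bar> + matching_dist B (B' - {b})"
    using serve_cost_attained assms by metis
  have "matching_dist (insert a (A' - {a})) (insert b (B' - {b}))
      \<le> \<bar>a - b\<bar> + matching_dist (A' - {a}) (B' - {b})"
    using assms a b fin by (intro matching_dist_insert_le) auto
  moreover have "matching_dist (A' - {a}) (B' - {b}) \<le>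
      matching_dist (A' - {a}) A + matching_dist A (B' - {b})"
    using assms a b fin by (intro matching_dist_triangle) auto
  moreover have "matching_dist A (B' - {b}) \<le> matching_dist A B + matching_dist B (B' - {b})"
    using assms a b fin by (intro matching_dist_triangle) auto
  moreover have "matching_dist (A' - {a}) A \<le> matching_dist A (A' - {a})"
    using assms a b fin by (intro matching_dist_commute_le) auto
  moreover have "\<bar>a - b\<bar> \<le> \<bar>r - a\<bar> + \<bar>r - b\<bar>" by simp
  moreover have "insert a (A' - {a}) = A'" "insert b (B' - {b}) = B'" using a b by auto
  ultimately show ?thesis unfolding a(2) b(2) by simp
qed

text \<open>An augmenting path: if \<open>x\<close> is already taken, continue from the point that \<open>f\<close> assigns to it.\<close>

lemma augment:
  fixes U :: "real set"
  assumes "finite U" "x \<in> X" "bij_betw f U (X - {x})"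
  shows "\<exists>p f'. p \<in> X - U \<and> bij_betw f' (insert p U) X \<and>
    \<bar>r - p\<bar> + (\<Sum>u\<in>insert p U. \<bar>u - f' u\<bar>) \<le> \<bar>r - x\<bar> + (\<Sum>u\<in>U. \<bar>u - f u\<bar>)"
  using assms
proof (induction "card U" arbitrary: U X x f rule: less_induct)
  case less
  show ?case
  proof (cases "x \<in> U")
    case False
    have "bij_betw (f(x := x)) U (X - {x})"
      using less.prems(3) False by (subst bij_betw_cong[where g = f]) auto
    then have "bij_betw (f(x := x)) ({x} \<union> U) ({x} \<union> (X - {x}))"
      by (intro bij_betw_combine) (auto simp: bij_betw_def)
    moreover have "{x} \<union> (X - {x}) = X" using less.prems by auto
    moreover have "(\<Sum>u\<in>insert x U. \<bar>u - (f(x := x)) u\<bar>) = (\<Sum>u\<in>U. \<bar>u - f u\<bar>)"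
      using False less.prems(1) by (auto intro!: sum.cong)
    ultimately show ?thesis
      using False less.prems by (intro exI[of _ x] exI[of _ "f(x := x)"]) auto
  next
    case True
    \<comment> \<open>Leaving out \<open>x\<close> on both sides makes \<open>f x\<close> the vacant
      target, so the induction hypothesis continues the path from there.\<close>
    let ?U = "U - {x}" and ?X = "X - {x}"
    have fx: "f x \<in> ?X" using less.prems True by (auto simp: bij_betw_def)
    have "bij_betw f ?U (?X - {f x})"
      using less.prems True by (auto simp: bij_betw_def inj_on_def)
    moreover have "card ?U < card U" "finite ?U"
      using card_Diff1_less[OF less.prems(1) True] less.prems(1) by blast+
    ultimately obtain p f' where p: "p \<in> ?X - ?U" "bij_betw f' (insert p ?U) ?X"
      and le: "\<bar>r - p\<bar> + (\<Sum>u\<in>insert p ?U. \<bar>u - f' u\<bar>) \<le> \<bar>r - f x\<bar> + (\<Sum>u\<in>?U. \<bar>u - f u\<bar>)"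
      using less.hyps[OF _ _ fx] by blast
    have xn: "x \<notin> insert p ?U" using p by auto
    have "bij_betw (f'(x := x)) (insert p ?U) ?X"
      using p(2) xn by (subst bij_betw_cong[where g = f']) auto
    then have "bij_betw (f'(x := x)) ({x} \<union> insert p ?U) ({x} \<union> ?X)"
      by (intro bij_betw_combine) (auto simp: bij_betw_def)
    moreover have "{x} \<union> ?X = X" "{x} \<union> insert p ?U = insert p U" using less.prems True by auto
    ultimately have bij: "bij_betw (f'(x := x)) (insert p U) X" by simp
    have "(\<Sum>u\<in>insert p U. \<bar>u - (f'(x := x)) u\<bar>) = (\<Sum>u\<in>insert x (insert p ?U). \<bar>u - (f'(x := x)) u\<bar>)"
      using True by (intro sum.cong) auto
    also have "\<dots> = (\<Sum>u\<in>insert p ?U. \<bar>u - (f'(x := x)) u\<bar>)"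
      using xn less.prems(1) by (subst sum.insert) auto
    also have "\<dots> = (\<Sum>u\<in>insert p ?U. \<bar>u - f' u\<bar>)"
      using xn by (intro sum.cong) auto
    finally have eq: "(\<Sum>u\<in>insert p U. \<bar>u - (f'(x := x)) u\<bar>) = (\<Sum>u\<in>insert p ?U. \<bar>u - f' u\<bar>)" .
    have "(\<Sum>u\<in>U. \<bar>u - f u\<bar>) = \<bar>x - f x\<bar> + (\<Sum>u\<in>?U. \<bar>u - f u\<bar>)"
      using True less.prems(1) by (simp add: sum.remove)
    \<comment> \<open>Now \<open>x\<close> stays in place, and the saved distance from
      \<open>x\<close> to \<open>f x\<close> pays for replacing \<open>f x\<close> by
      \<open>x\<close> next to \<open>r\<close>.\<close>
    then have "\<bar>r - p\<bar> + (\<Sum>u\<in>insert p U. \<bar>u - (f'(x := x)) u\<bar>) \<le> \<bar>r - x\<bar> + (\<Sum>u\<in>U. \<bar>u - f u\<bar>)"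
      using le eq by (simp add: abs_if split: if_splits)
    moreover have "p \<in> X - U" using p True by auto
    ultimately show ?thesis using bij by blast
  qed
qed

definition pick :: "real set \<Rightarrow> real \<Rightarrow> real set \<Rightarrow> real" where
  "pick U r X = (SOME p. p \<in> X - U \<and> \<bar>r - p\<bar> + matching_dist (insert p U) X \<le> serve_cost U r X)"

lemma pick:
  assumes "finite U" "card X = Suc (card U)"
  shows "pick U r X \<in> X - U"
    "\<bar>r - pick U r X\<bar> + matching_dist (insert (pick U r X) U) X \<le> serve_cost U r X"
proof -
  obtain x where x: "x \<in> X" "serve_cost U r X = \<bar>r - x\<bar> + matching_dist U (X - {x})"
    using serve_cost_attained assms by metis
  have fX: "finite X" using assms card.infinite by force
  obtain f where f: "bij_betw f U (X - {x})" "matching_dist U (X - {x}) = (\<Sum>u\<in>U. \<bar>u - f u\<bar>)"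
    using matching_dist_attained[of U "X - {x}"] assms x fX by auto
  obtain p f' where p: "p \<in> X - U" "bij_betw f' (insert p U) X"
    "\<bar>r - p\<bar> + (\<Sum>u\<in>insert p U. \<bar>u - f' u\<bar>) \<le> \<bar>r - x\<bar> + (\<Sum>u\<in>U. \<bar>u - f u\<bar>)"
    using augment[OF assms(1) x(1) f(1)] by blast
  have "matching_dist (insert p U) X \<le> (\<Sum>u\<in>insert p U. \<bar>u - f' u\<bar>)"
    using p assms by (intro matching_dist_le) auto
  with p x f have "\<exists>p. p \<in> X - U \<and> \<bar>r - p\<bar> + matching_dist (insert p U) X \<le> serve_cost U r X"
    by (intro exI[of _ p]) auto
  from someI_ex[OF this] show "pick U r X \<in> X - U"
    "\<bar>r - pick U r X\<bar> + matching_dist (insert (pick U r X) U) X \<le> serve_cost U r X"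
    unfolding pick_def by auto
qed

text \<open>Configuration rules take reversed histories: the head is the current round.\<close>

type_synonym config_rule = "real set \<Rightarrow> (real \<times> real set) list \<Rightarrow> real set"

text \<open>Histories are reversed, so the suffixes \<open>y\<close> are exactly the earlier
  histories.\<close>

definition legal :: "config_rule \<Rightarrow> real set \<Rightarrow> (real \<times> real set) list \<Rightarrow> bool" where
  "legal K S h \<longleftrightarrow> (\<forall>z y. h = z @ y \<longrightarrow> K S y \<subseteq> S \<and> card (K S y) = length y)"

lemma legal_Cons: "legal K S (e # h) \<longleftrightarrow> K S (e # h) \<subseteq> S \<and> card (K S (e # h)) = Suc (length h) \<and> legal K S h"
  unfolding legal_def by (auto simp: Cons_eq_append_conv)

lemma legalD: "legal K S h \<Longrightarrow> K S h \<subseteq> S" "legal K S h \<Longrightarrow> card (K S h) = length h"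
  unfolding legal_def by auto

primrec config_cost :: "config_rule \<Rightarrow> real set \<Rightarrow> (real \<times> real set) list \<Rightarrow> real" where
  "config_cost K S [] = 0"
| "config_cost K S (e # h) = serve_cost (K S h) (fst e) (K S (e # h)) + config_cost K S h"

primrec follow :: "config_rule \<Rightarrow> real set \<Rightarrow> (real \<times> real set) list \<Rightarrow> real list" where
  "follow K S [] = []"
| "follow K S (e # h) = pick (set (follow K S h)) (fst e) (K S (e # h)) # follow K S h"

definition serving_cost :: "(real \<times> real set) list \<Rightarrow> real list \<Rightarrow> real" where
  "serving_cost h cs = (\<Sum>(e, c)\<leftarrow>zip h cs. \<bar>fst e - c\<bar>)"

text \<open>The distance from the servers used so far to the followed configuration is a potential.
  \<open>pick\<close> buys its server and the new distance for \<open>serve_cost\<close>, and by the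
  triangle inequality the old distance pays for starting from another configuration.\<close>

lemma follow_cost:
  assumes "finite S" "legal K S h"
  shows "distinct (follow K S h) \<and> set (follow K S h) \<subseteq> S \<and> length (follow K S h) = length h \<and>
    serving_cost h (follow K S h) + matching_dist (set (follow K S h)) (K S h) \<le> config_cost K S h"
  using assms(2)
proof (induction h)
  case Nil
  then have "K S [] = {}"
    using assms(1) legalD[OF Nil] by (auto dest: finite_subset)
  then show ?case using matching_dist_self_le[of "{}"] by (simp add: serving_cost_def)
next
  case (Cons e h)
  let ?U = "set (follow K S h)" and ?X = "K S (e # h)"
  let ?p = "pick ?U (fst e) ?X"
  have IH: "distinct (follow K S h)" "?U \<subseteq> S" "length (follow K S h) = length h"
    "serving_cost h (follow K S h) + matching_dist ?U (K S h) \<le> config_cost K S h"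
    using Cons.IH Cons.prems by (simp_all add: legal_Cons)
  have cU: "card ?U = length h" using IH by (simp add: distinct_card)
  have L: "K S h \<subseteq> S" "card (K S h) = length h" "?X \<subseteq> S" "card ?X = Suc (length h)"
    using Cons.prems legalD[of K S h] by (auto simp: legal_Cons)
  have p: "?p \<in> ?X - ?U" "\<bar>fst e - ?p\<bar> + matching_dist (insert ?p ?U) ?X \<le> serve_cost ?U (fst e) ?X"
    using pick[of ?U ?X "fst e"] cU L by simp_all
  have "serve_cost ?U (fst e) ?X \<le> matching_dist ?U (K S h) + serve_cost (K S h) (fst e) ?X"
    using cU L finite_subset[OF L(1) assms(1)] by (intro serve_cost_triangle) auto
  moreover have "serving_cost (e # h) (follow K S (e # h)) = \<bar>fst e - ?p\<bar> + serving_cost h (follow K S h)"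
    by (simp add: serving_cost_def)
  ultimately have "serving_cost (e # h) (follow K S (e # h)) + matching_dist (set (follow K S (e # h))) ?X
      \<le> config_cost K S (e # h)"
    using p IH(4) by simp
  then show ?case using p(1) IH(1-3) L(3) by auto
qed

lemma config_cost_nonneg:
  assumes "finite S" "legal K S h"
  shows "0 \<le> config_cost K S h"
  using assms(2)
proof (induction h)
  case (Cons e h)
  then have "0 \<le> serve_cost (K S h) (fst e) (K S (e # h))"
    using assms(1) legalD[of K S h]
    by (intro serve_cost_nonneg) (auto simp: legal_Cons dest: finite_subset)
  with Cons show ?case by (simp add: legal_Cons)
qed simp

text \<open>Both sequences start empty and serve the same requests, so by
  \<open>matching_dist_serve\<close> each round increases their distance by at most the two serving
  costs.\<close>

lemma matching_dist_configs:
  assumes "finite S" "legal K S h" "legal K' S h"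
  shows "matching_dist (K S h) (K' S h) \<le> config_cost K S h + config_cost K' S h"
  using assms(2-)
proof (induction h)
  case Nil
  then have "K S [] = {}" "K' S [] = {}"
    using assms(1) legalD[of K S "[]"] legalD[of K' S "[]"] by (auto dest: finite_subset)
  then show ?case using matching_dist_self_le[of "{}"] by simp
next
  case (Cons e h)
  then have "matching_dist (K S (e # h)) (K' S (e # h)) \<le> matching_dist (K S h) (K' S h)
      + serve_cost (K S h) (fst e) (K S (e # h)) + serve_cost (K' S h) (fst e) (K' S (e # h))"
    using assms(1) legalD[of K S h] legalD[of K' S h]
    by (intro matching_dist_serve) (auto simp: legal_Cons dest: finite_subset)
  with Cons show ?case by (simp add: legal_Cons)
qed

lemma switch_cost:
  assumes "finite S" "legal K S (e # h)" "legal K' S (e # h)"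
  shows "serve_cost (K S h) (fst e) (K' S (e # h)) \<le> config_cost K S h + config_cost K' S (e # h)"
proof -
  have "serve_cost (K S h) (fst e) (K' S (e # h))
      \<le> matching_dist (K S h) (K' S h) + serve_cost (K' S h) (fst e) (K' S (e # h))"
    using assms legalD[of K S h] legalD[of K' S h]
    by (intro serve_cost_triangle) (auto simp: legal_Cons dest: finite_subset)
  with matching_dist_configs[of S K h K'] assms show ?thesis by (simp add: legal_Cons)
qed

text \<open>
  Switching as soon as the current rule has become more than twice as expensive as the other one
  makes the cost of the current rule at least quadruple between two switches.
\<close>

context
  fixes K1 K2 :: config_rule
begin

primrec use_first :: "real set \<Rightarrow> (real \<times> real set) list \<Rightarrow> bool" where
  "use_first S [] = True"
| "use_first S (e # h) =
    (if use_first S h then config_cost K1 S (e # h) \<le> 2 * config_cost K2 S (e # h)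
     else 2 * config_cost K1 S (e # h) < config_cost K2 S (e # h))"

definition combine :: config_rule where
  "combine S h = (if use_first S h then K1 S h else K2 S h)"

lemma legal_combine: "legal K1 S h \<Longrightarrow> legal K2 S h \<Longrightarrow> legal combine S h"
  unfolding legal_def combine_def by auto

lemma combine_cost:
  assumes "finite S" "legal K1 S h" "legal K2 S h"
  shows "config_cost combine S h \<le> 9 * min (config_cost K1 S h) (config_cost K2 S h)"
proof -
  define cur where "cur h = (if use_first S h then config_cost K1 S h else config_cost K2 S h)" for h
  define oth where "oth h = (if use_first S h then config_cost K2 S h else config_cost K1 S h)" for h
  \<comment> \<open>The witness \<open>s\<close> is the cost of the current rule when it was last
    adopted, and 0 before any switch. The other rule then had at least twice that cost, which
    remains true by monotonicity.\<close>
  have "cur h \<le> 2 * oth h \<and> (\<exists>s\<ge>0. config_cost combine S h \<le> cur h + 8 * s \<and> s \<le> cur h \<and> 2 * s \<le> oth h)"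
    using assms(2-)
  proof (induction h)
    case Nil
    show ?case by (auto simp: cur_def oth_def intro!: exI[of _ 0])
  next
    case (Cons e h)
    then obtain s where IH: "cur h \<le> 2 * oth h" "s \<ge> 0" "config_cost combine S h \<le> cur h + 8 * s"
      "s \<le> cur h" "2 * s \<le> oth h" by (auto simp: legal_Cons)
    have fin: "finite (K1 S h)" "card (K1 S h) = length h" "finite (K2 S h)" "card (K2 S h) = length h"
      using Cons.prems assms(1) legalD[of K1 S h] legalD[of K2 S h] by (auto simp: legal_Cons dest: finite_subset)
    have mono: "config_cost K1 S h \<le> config_cost K1 S (e # h)" "config_cost K2 S h \<le> config_cost K2 S (e # h)"
      using serve_cost_nonneg[of "K1 S h" "K1 S (e # h)" "fst e"]
        serve_cost_nonneg[of "K2 S h" "K2 S (e # h)" "fst e"]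
        Cons.prems fin
      by (auto simp: legal_Cons)
    note sw = switch_cost[OF assms(1) Cons.prems] switch_cost[OF assms(1) Cons.prems(2,1)]
    note nn = config_cost_nonneg[OF assms(1) Cons.prems(1)] config_cost_nonneg[OF assms(1) Cons.prems(2)]
    show ?case
    proof (cases "use_first S (e # h) = use_first S h")
      case True
      have "cur (e # h) \<le> 2 * oth (e # h)"
        using True by (auto simp: cur_def oth_def)
      moreover have "config_cost combine S (e # h) \<le> cur (e # h) + 8 * s"
        using True IH by (auto simp: cur_def combine_def)
      moreover have "s \<le> cur (e # h)" "2 * s \<le> oth (e # h)"
        using True IH mono by (auto simp: cur_def oth_def)
      ultimately show ?thesis using IH(2) by blast
    next
      case False
      have gt: "2 * cur (e # h) < oth (e # h)"
        using False by (auto simp: cur_def oth_def split: if_splits)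
      have "serve_cost (combine S h) (fst e) (combine S (e # h)) \<le> cur h + cur (e # h)"
        using False sw by (auto simp: cur_def combine_def simp del: config_cost.simps use_first.simps)
      moreover have "oth h \<le> cur (e # h)"
        using False mono by (auto simp: cur_def oth_def simp del: config_cost.simps use_first.simps)
      moreover have "config_cost combine S (e # h) =
          serve_cost (combine S h) (fst e) (combine S (e # h)) + config_cost combine S h" by simp
      \<comment> \<open>The total is at most \<open>2 * cur h + 8 * s + cur (e # h)\<close>. Here
        \<open>cur h\<close> is at most \<open>2 * oth h\<close>, \<open>2 * s\<close> is at most
        \<open>oth h\<close>, and \<open>oth h\<close> is at most \<open>cur (e # h)\<close>, which
        gives 4 + 4 + 1.\<close>
      ultimately have "config_cost combine S (e # h) \<le> cur (e # h) + 8 * cur (e # h)"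
        using IH by linarith
      moreover have "0 \<le> cur (e # h)" using nn by (auto simp: cur_def)
      ultimately show ?thesis using gt by (intro conjI exI[of _ "cur (e # h)"]) auto
    qed
  qed
  then have "config_cost combine S h \<le> 9 * cur h" "config_cost combine S h \<le> 9 * oth h"
    using config_cost_nonneg[OF assms(1,2)] config_cost_nonneg[OF assms(1,3)]
    by (auto simp: oth_def split: if_splits)
  then show ?thesis by (auto simp: cur_def oth_def min_def split: if_splits)
qed

end

section \<open>Net costs and stability\<close>

text \<open>
  Servers are numbered from left to right. In the following, \<open>D k\<close> is the number
  of used servers minus the number of requests at positions up to \<open>k\<close>, that is, the
  flow from right to left across the gap between the servers \<open>k\<close> and
  \<open>Suc k\<close>. The rates price one more unit of flow to the left or to the right: new
  flow costs 2 per unit of length, whereas cancelling flow refunds 1.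
\<close>

definition left_rate :: "int \<Rightarrow> real" where "left_rate d = (if d \<ge> 0 then 2 else - 1)"
definition right_rate :: "int \<Rightarrow> real" where "right_rate d = (if d \<le> 0 then 2 else - 1)"

definition robust_choice :: "(nat \<Rightarrow> real) \<Rightarrow> nat \<Rightarrow> nat set \<Rightarrow> (nat \<Rightarrow> int) \<Rightarrow> nat \<Rightarrow> nat" where
  "robust_choice s n U D q =
    (let As = {a. a < q \<and> a \<notin> U}; Bs = {b. q < b \<and> b < n \<and> b \<notin> U}; a = Max As; b = Min Bs in
     if q \<notin> U then q else if As = {} then b else if Bs = {} then a
     else if (\<Sum>k=a..<q. left_rate (D k) * (s (Suc k) - s k)) \<le> (\<Sum>k=q..<b. right_rate (D k) * (s (Suc k) - s k))
     then a else b)"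

lemma sum_split: "a \<le> b \<Longrightarrow> b \<le> c \<Longrightarrow> (\<Sum>k=a..<c. f k) = (\<Sum>k=a..<b. f k) + (\<Sum>k=b..<c. f (k::nat) :: real)"
  by (simp add: sum.atLeastLessThan_concat)

context
  fixes s :: "nat \<Rightarrow> real" and n :: nat
begin

abbreviation gap :: "nat \<Rightarrow> real" where "gap k \<equiv> s (Suc k) - s k"

abbreviation costL :: "(nat \<Rightarrow> int) \<Rightarrow> nat \<Rightarrow> nat \<Rightarrow> real" where
  "costL D a u \<equiv> \<Sum>k=a..<u. left_rate (D k) * gap k"

abbreviation costR :: "(nat \<Rightarrow> int) \<Rightarrow> nat \<Rightarrow> nat \<Rightarrow> real" where
  "costR D u b \<equiv> \<Sum>k=u..<b. right_rate (D k) * gap k"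

text \<open>\<open>costL D a u\<close> is the net price of sending one more unit from
  \<open>u\<close> left to \<open>a\<close>. Stability is a residual condition: despite refunds, no
  path to a free server has a negative price.\<close>

definition stableL :: "nat set \<Rightarrow> (nat \<Rightarrow> int) \<Rightarrow> bool" where
  "stableL U D \<longleftrightarrow> (\<forall>a u. a \<notin> U \<longrightarrow> a \<le> u \<longrightarrow> u < n \<longrightarrow> 0 \<le> costL D a u)"

definition stableR :: "nat set \<Rightarrow> (nat \<Rightarrow> int) \<Rightarrow> bool" where
  "stableR U D \<longleftrightarrow> (\<forall>u b. b \<notin> U \<longrightarrow> u \<le> b \<longrightarrow> b < n \<longrightarrow> 0 \<le> costR D u b)"

definition choice_ok :: "nat set \<Rightarrow> (nat \<Rightarrow> int) \<Rightarrow> nat \<Rightarrow> nat \<Rightarrow> bool" where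
  "choice_ok U D q c \<longleftrightarrow> c < n \<and> c \<notin> U \<and>
    (c < q \<longrightarrow> {c<..q} \<subseteq> U \<and> (\<forall>b. q < b \<longrightarrow> b < n \<longrightarrow> b \<notin> U \<longrightarrow> costL D c q \<le> costR D q b)) \<and>
    (q < c \<longrightarrow> {q..<c} \<subseteq> U \<and> (\<forall>a. a < q \<longrightarrow> a \<notin> U \<longrightarrow> costR D q c \<le> costL D a q))"

text \<open>On either side the nearest free server is also the cheapest: by stability, the stretch
  from it to a farther free server has nonnegative net cost. Hence it suffices to compare the two
  nearest ones.\<close>

lemma choice_ok_robust_choice:
  assumes "stableL U D" "stableR U D" "q < n" "\<exists>p<n. p \<notin> U"
  shows "choice_ok U D q (robust_choice s n U D q)"
proof (cases "q \<in> U")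
  case False
  then show ?thesis using assms by (simp add: choice_ok_def robust_choice_def Let_def)
next
  case True
  define As where "As = {a. a < q \<and> a \<notin> U}"
  define Bs where "Bs = {b. q < b \<and> b < n \<and> b \<notin> U}"
  define a where "a = Max As"
  define b where "b = Min Bs"
  have fin: "finite As" "finite Bs" by (auto simp: As_def Bs_def)
  have ne: "As \<noteq> {} \<or> Bs \<noteq> {}"
  proof -
    obtain p where "p < n" "p \<notin> U" using assms by blast
    moreover then have "p < q \<or> q < p" using True by (metis linorder_neqE_nat)
    ultimately show ?thesis by (auto simp: As_def Bs_def)
  qed
  have a: "a < q" "a \<notin> U" "a < n" "{a<..q} \<subseteq> U"
    "\<And>a'. a' < q \<Longrightarrow> a' \<notin> U \<Longrightarrow> costL D a q \<le> costL D a' q" if "As \<noteq> {}"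
  proof -
    have "a \<in> As" using fin(1) that unfolding a_def by (rule Max_in)
    then show a: "a < q" "a \<notin> U" "a < n" using assms by (auto simp: As_def)
    have le: "a' \<le> a" if "a' < q" "a' \<notin> U" for a'
      unfolding a_def using fin that by (intro Max_ge) (auto simp: As_def)
    show "{a<..q} \<subseteq> U"
    proof
      fix z assume z: "z \<in> {a<..q}"
      show "z \<in> U" using le[of z] z True by (cases "z = q") auto
    qed
    fix a' assume a': "a' < q" "a' \<notin> U"
    have "costL D a' q = costL D a' a + costL D a q"
      using le[OF a'] a by (intro sum_split) auto
    moreover have "0 \<le> costL D a' a"
      using assms(1) a' le[OF a'] a by (auto simp: stableL_def)
    ultimately show "costL D a q \<le> costL D a' q" by simp
  qed
  have b: "q < b" "b \<notin> U" "b < n" "{q..<b} \<subseteq> U"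
    "\<And>b'. q < b' \<Longrightarrow> b' < n \<Longrightarrow> b' \<notin> U \<Longrightarrow> costR D q b \<le> costR D q b'" if "Bs \<noteq> {}"
  proof -
    have "b \<in> Bs" using fin that unfolding b_def by (intro Min_in)
    then show b: "q < b" "b \<notin> U" "b < n" by (auto simp: Bs_def)
    have le: "b \<le> b'" if "q < b'" "b' < n" "b' \<notin> U" for b'
      unfolding b_def using fin that by (intro Min_le) (auto simp: Bs_def)
    show "{q..<b} \<subseteq> U"
    proof
      fix z assume z: "z \<in> {q..<b}"
      show "z \<in> U" using le[of z] z b True by (cases "z = q") auto
    qed
    fix b' assume b': "q < b'" "b' < n" "b' \<notin> U"
    have "costR D q b' = costR D q b + costR D b b'"
      using le[OF b'] b by (intro sum_split) auto
    moreover have "0 \<le> costR D b b'"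
      using assms(2) b' le[OF b'] by (auto simp: stableR_def)
    ultimately show "costR D q b \<le> costR D q b'" by simp
  qed
  have rc: "robust_choice s n U D q =
     (if As = {} then b else if Bs = {} then a else if costL D a q \<le> costR D q b then a else b)"
    unfolding robust_choice_def Let_def As_def[symmetric] Bs_def[symmetric] a_def[symmetric] b_def[symmetric]
    by (simp only: True not_True_eq_False if_False)
  show ?thesis
  proof (cases "As = {} \<or> Bs \<noteq> {} \<and> \<not> costL D a q \<le> costR D q b")
    case True
    then have "Bs \<noteq> {}" "robust_choice s n U D q = b" using rc ne by auto
    moreover have "costR D q b \<le> costL D a' q" if "a' < q" "a' \<notin> U" for a'
    proof -
      have "As \<noteq> {}" using that by (auto simp: As_def)
      with True a(5)[OF _ that] show ?thesis by simp
    qed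
    ultimately show ?thesis using b by (auto simp: choice_ok_def)
  next
    case False
    then have "As \<noteq> {}" "robust_choice s n U D q = a" using rc ne by auto
    moreover have "costL D a q \<le> costR D q b'" if "q < b'" "b' < n" "b' \<notin> U" for b'
    proof -
      have "Bs \<noteq> {}" using that by (auto simp: Bs_def)
      with False b(5)[OF _ that] show ?thesis by simp
    qed
    ultimately show ?thesis using a by (auto simp: choice_ok_def)
  qed
qed

definition serve :: "nat \<Rightarrow> nat \<Rightarrow> (nat \<Rightarrow> int) \<Rightarrow> nat \<Rightarrow> int" where
  "serve q c D k = D k + of_bool (c \<le> k) - of_bool (q \<le> k)"

text \<open>If \<open>D\<close> is the discrepancy between used servers and requests, this is their
  transport distance on the line. It serves as a potential.\<close>

definition volume :: "(nat \<Rightarrow> int) \<Rightarrow> real" where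
  "volume D = (\<Sum>k<n - 1. \<bar>real_of_int (D k)\<bar> * gap k)"

section \<open>Preservation of stability, and lengths versus net costs\<close>

context
  assumes mono: "\<And>k. Suc k < n \<Longrightarrow> s k \<le> s (Suc k)"
begin

lemma s_mono: "i \<le> j \<Longrightarrow> j < n \<Longrightarrow> s i \<le> s j"
  by (induction j rule: nat_induct_at_least[of i, consumes 1]) (auto intro: order_trans[OF _ mono])

text \<open>Serving to the left only raises left rates. After serving to the right, a left path from
  a point between \<open>q\<close> and \<open>c\<close> to \<open>q\<close> costs at least minus the
  old right path, and the choice rule made the right path to \<open>c\<close> no more expensive than
  the left path from \<open>q\<close> to any free server.\<close>

lemma stableL_serve:
  assumes "stableL U D" "stableR U D" "q < n" "choice_ok U D q c"
  shows "stableL (insert c U) (serve q c D)"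
proof (cases "c \<le> q")
  case True
  show ?thesis
    unfolding stableL_def
  proof (intro allI impI)
    fix a u assume a: "a \<notin> insert c U" "a \<le> u" "u < n"
    have "costL D a u \<le> costL (serve q c D) a u"
      using True a mono by (intro sum_mono mult_right_mono) (auto simp: serve_def left_rate_def)
    moreover have "0 \<le> costL D a u" using assms(1) a by (auto simp: stableL_def)
    ultimately show "0 \<le> costL (serve q c D) a u" by simp
  qed
next
  case False
  then have c: "q < c" "c < n" "c \<notin> U" "{q..<c} \<subseteq> U"
    and le: "\<And>a. a < q \<Longrightarrow> a \<notin> U \<Longrightarrow> costR D q c \<le> costL D a q"
    using assms(4) by (auto simp: choice_ok_def)
  show ?thesis
    unfolding stableL_def
  proof (intro allI impI)
    fix a u assume a: "a \<notin> insert c U" "a \<le> u" "u < n"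
    have old: "0 \<le> costL D a u" using assms(1) a by (auto simp: stableL_def)
    show "0 \<le> costL (serve q c D) a u"
    proof (cases "u \<le> q \<or> c < a")
      case True
      then have "costL (serve q c D) a u = costL D a u"
        using c a by (intro sum.cong) (auto simp: serve_def)
      with old show ?thesis by simp
    next
      case False
      then have aq: "a < q" using a c by (metis atLeastLessThan_iff insertCI linorder_le_less_linear linorder_neqE_nat subsetD)
      have upto: "0 \<le> costL (serve q c D) a v" if v: "q \<le> v" "v \<le> c" for v
      proof -
        have 1: "costL (serve q c D) a v = costL (serve q c D) a q + costL (serve q c D) q v"
          using aq v by (intro sum_split) auto
        have 2: "costL (serve q c D) a q = costL D a q"
          using c by (intro sum.cong) (auto simp: serve_def)
        \<comment> \<open>For every \<open>d\<close>,
          \<open>left_rate (d - 1) + right_rate d = 1\<close>.\<close>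
        have "costL (serve q c D) q v = (\<Sum>k=q..<v. (1 - right_rate (D k)) * gap k)"
          using v by (intro sum.cong) (auto simp: serve_def left_rate_def right_rate_def)
        also have "\<dots> \<ge> (\<Sum>k=q..<v. - right_rate (D k) * gap k)"
          using v c mono by (intro sum_mono mult_right_mono) auto
        also have "(\<Sum>k=q..<v. - right_rate (D k) * gap k) = costR D v c - costR D q c"
          using sum_split[OF v, of "\<lambda>k. right_rate (D k) * gap k"] by (simp add: sum_negf)
        finally have "costL D a q + (costR D v c - costR D q c) \<le> costL (serve q c D) a v"
          unfolding 1 2 by (rule add_left_mono)
        moreover have "0 \<le> costR D v c" using assms(2) c v by (auto simp: stableR_def)
        ultimately show ?thesis using le[of a] aq a by auto
      qed
      show ?thesis
      proof (cases "u \<le> c")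
        case True
        with upto[of u] \<open>\<not> (u \<le> q \<or> c < a)\<close> show ?thesis by auto
      next
        case False
        \<comment> \<open>Beyond \<open>c\<close> nothing has changed, and \<open>c\<close> was free
          before, so the old stability applies to the part from \<open>c\<close> on.\<close>
        have "costL (serve q c D) a u = costL (serve q c D) a c + costL (serve q c D) c u"
          using aq c False by (intro sum_split) auto
        moreover have "costL (serve q c D) c u = costL D c u"
          using c by (intro sum.cong) (auto simp: serve_def)
        moreover have "0 \<le> costL D c u" using assms(1) c False a by (auto simp: stableL_def)
        ultimately show ?thesis using upto[of c] c by auto
      qed
    qed
  qed
qed

text \<open>Mirror image of \<open>stableL_serve\<close>, with
  \<open>left_rate d + right_rate (d + 1) = 1\<close>.\<close>

lemma stableR_serve:
  assumes "stableL U D" "stableR U D" "q < n" "choice_ok U D q c"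
  shows "stableR (insert c U) (serve q c D)"
proof (cases "q \<le> c")
  case True
  show ?thesis
    unfolding stableR_def
  proof (intro allI impI)
    fix u b assume b: "b \<notin> insert c U" "u \<le> b" "b < n"
    have "costR D u b \<le> costR (serve q c D) u b"
      using True b mono by (intro sum_mono mult_right_mono) (auto simp: serve_def right_rate_def)
    moreover have "0 \<le> costR D u b" using assms(2) b by (auto simp: stableR_def)
    ultimately show "0 \<le> costR (serve q c D) u b" by simp
  qed
next
  case False
  then have c: "c < q" "c < n" "c \<notin> U" "{c<..q} \<subseteq> U"
    and le: "\<And>b. q < b \<Longrightarrow> b < n \<Longrightarrow> b \<notin> U \<Longrightarrow> costL D c q \<le> costR D q b"
    using assms(4) by (auto simp: choice_ok_def)
  show ?thesis
    unfolding stableR_def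
  proof (intro allI impI)
    fix u b assume b: "b \<notin> insert c U" "u \<le> b" "b < n"
    have old: "0 \<le> costR D u b" using assms(2) b by (auto simp: stableR_def)
    show "0 \<le> costR (serve q c D) u b"
    proof (cases "q \<le> u \<or> b < c")
      case True
      then have "costR (serve q c D) u b = costR D u b"
        using c b by (intro sum.cong) (auto simp: serve_def)
      with old show ?thesis by simp
    next
      case False
      then have qb: "q < b" using b c by (metis greaterThanAtMost_iff insertCI linorder_le_less_linear linorder_neqE_nat subsetD)
      have from_c: "0 \<le> costR (serve q c D) v b" if v: "c \<le> v" "v \<le> q" for v
      proof -
        have 1: "costR (serve q c D) v b = costR (serve q c D) v q + costR (serve q c D) q b"
          using qb v by (intro sum_split) auto
        have 2: "costR (serve q c D) q b = costR D q b"
          using c by (intro sum.cong) (auto simp: serve_def)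
        have "costR (serve q c D) v q = (\<Sum>k=v..<q. (1 - left_rate (D k)) * gap k)"
          using v by (intro sum.cong) (auto simp: serve_def left_rate_def right_rate_def)
        also have "\<dots> \<ge> (\<Sum>k=v..<q. - left_rate (D k) * gap k)"
          using v assms(3) mono by (intro sum_mono mult_right_mono) auto
        also have "(\<Sum>k=v..<q. - left_rate (D k) * gap k) = costL D c v - costL D c q"
          using sum_split[OF v, of "\<lambda>k. left_rate (D k) * gap k"] by (simp add: sum_negf)
        finally have "costL D c v - costL D c q + costR D q b \<le> costR (serve q c D) v b"
          unfolding 1 2 by (rule add_right_mono)
        moreover have "0 \<le> costL D c v" using assms(1,3) c v by (auto simp: stableL_def)
        ultimately show ?thesis using le[of b] qb b by auto
      qed
      show ?thesis
      proof (cases "c \<le> u")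
        case True
        with from_c[of u] \<open>\<not> (q \<le> u \<or> b < c)\<close> show ?thesis by auto
      next
        case False
        have "costR (serve q c D) u b = costR (serve q c D) u c + costR (serve q c D) c b"
          using qb c False by (intro sum_split) auto
        moreover have "costR (serve q c D) u c = costR D u c"
          using c by (intro sum.cong) (auto simp: serve_def)
        moreover have "0 \<le> costR D u c" using assms(2) c False b by (auto simp: stableR_def)
        ultimately show ?thesis using from_c[of c] c by auto
      qed
    qed
  qed
qed

lemma telescope: "a \<le> b \<Longrightarrow> (\<Sum>k=a..<b. gap k) = s b - s a"
  by (rule sum_Suc_diff')

text \<open>The potential \<open>3 * volume\<close> turns lengths into twice the net costs.\<close>

lemma serve_length:
  assumes "choice_ok U D q c" "q < n" "p < n" "p \<notin> U"
  shows "\<bar>s c - s q\<bar> + 3 * (volume (serve q c D) - volume D) \<le> 4 * \<bar>s p - s q\<bar>"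
proof -
  have c: "c < n" "c \<notin> U" using assms by (auto simp: choice_ok_def)
  have vol: "volume (serve q c D) - volume D =
      (\<Sum>k\<in>A. (\<bar>real_of_int (serve q c D k)\<bar> - \<bar>real_of_int (D k)\<bar>) * gap k)"
    if "A \<subseteq> {..<n - 1}" "\<And>k. k \<notin> A \<Longrightarrow> serve q c D k = D k" for A
  proof -
    have "volume (serve q c D) - volume D =
      (\<Sum>k<n - 1. (\<bar>real_of_int (serve q c D k)\<bar> - \<bar>real_of_int (D k)\<bar>) * gap k)"
      by (simp add: volume_def sum_subtractf left_diff_distrib)
    also have "\<dots> = (\<Sum>k\<in>A. (\<bar>real_of_int (serve q c D k)\<bar> - \<bar>real_of_int (D k)\<bar>) * gap k)"
      using that by (intro sum.mono_neutral_right) auto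
    finally show ?thesis .
  qed
  have leL: "costL D a q \<le> 2 * (s q - s a)" if "a < q" for a
  proof -
    have "costL D a q \<le> (\<Sum>k=a..<q. 2 * gap k)"
      using that assms mono by (intro sum_mono mult_right_mono) (auto simp: left_rate_def)
    also have "\<dots> = 2 * (s q - s a)" using telescope[of a q] that by (simp only: sum_distrib_left[symmetric] less_imp_le)
    finally show ?thesis .
  qed
  have leR: "costR D q b \<le> 2 * (s b - s q)" if "q < b" "b < n" for b
  proof -
    have "costR D q b \<le> (\<Sum>k=q..<b. 2 * gap k)"
      using that assms mono by (intro sum_mono mult_right_mono) (auto simp: right_rate_def)
    also have "\<dots> = 2 * (s b - s q)" using telescope[of q b] that by (simp only: sum_distrib_left[symmetric] less_imp_le)
    finally show ?thesis .
  qed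
  consider "c = q" | "c < q" | "q < c" by linarith
  then show ?thesis
  proof cases
    case 1
    with vol[of "{}"] show ?thesis by (simp add: serve_def)
  next
    case 2
    have used: "{c<..q} \<subseteq> U"
      and le: "\<And>b. q < b \<Longrightarrow> b < n \<Longrightarrow> b \<notin> U \<Longrightarrow> costL D c q \<le> costR D q b"
      using assms(1) 2 unfolding choice_ok_def by blast+
    have "volume (serve q c D) - volume D =
        (\<Sum>k=c..<q. (\<bar>real_of_int (serve q c D k)\<bar> - \<bar>real_of_int (D k)\<bar>) * gap k)"
      using 2 assms by (intro vol) (auto simp: serve_def)
    also have "\<dots> = (\<Sum>k=c..<q. (if D k \<ge> 0 then 1 else -1) * gap k)"
      using 2 by (intro sum.cong) (auto simp: serve_def)
    finally have v: "volume (serve q c D) - volume D = (\<Sum>k=c..<q. (if D k \<ge> 0 then 1 else -1) * gap k)" .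
    \<comment> \<open>Per unit of length, new flow gives 3 + 1 = 2 * 2, and cancelled flow gives - 3
      + 1 = 2 * (- 1).\<close>
    have eq: "3 * (volume (serve q c D) - volume D) + (s q - s c) = 2 * costL D c q"
      unfolding v telescope[OF less_imp_le[OF 2], symmetric] sum_distrib_left sum.distrib[symmetric]
      by (intro sum.cong) (auto simp: left_rate_def)
    \<comment> \<open>Rates are at most 2. A free \<open>p\<close> on the same side is at least as
      far away as \<open>c\<close>; for one on the other side the choice rule compares the net
      costs.\<close>
    have "costL D c q \<le> 2 * \<bar>s p - s q\<bar>"
    proof (cases "p < q")
      case True
      then have "p \<le> c" using used assms(4) by (meson greaterThanAtMost_iff less_imp_le not_le subsetD)
      then have "s p \<le> s c" using c s_mono by auto
      then show ?thesis using leL[OF 2] s_mono[of c q] 2 assms by simp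
    next
      case False
      moreover have "q \<in> U" using used 2 by auto
      ultimately have "q < p" using assms(4) by (metis linorder_neqE_nat)
      then have "costL D c q \<le> costR D q p" using le assms(3,4) by blast
      then show ?thesis using leR[OF \<open>q < p\<close>] assms abs_ge_self[of "s p - s q"] by simp
    qed
    with eq s_mono[of c q] 2 assms show ?thesis by simp
  next
    case 3
    have used: "{q..<c} \<subseteq> U"
      and le: "\<And>a. a < q \<Longrightarrow> a \<notin> U \<Longrightarrow> costR D q c \<le> costL D a q"
      using assms(1) 3 unfolding choice_ok_def by blast+
    have "volume (serve q c D) - volume D =
        (\<Sum>k=q..<c. (\<bar>real_of_int (serve q c D k)\<bar> - \<bar>real_of_int (D k)\<bar>) * gap k)"
      using 3 c by (intro vol) (auto simp: serve_def)
    also have "\<dots> = (\<Sum>k=q..<c. (if D k \<le> 0 then 1 else -1) * gap k)"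
      using 3 by (intro sum.cong) (auto simp: serve_def)
    finally have v: "volume (serve q c D) - volume D = (\<Sum>k=q..<c. (if D k \<le> 0 then 1 else -1) * gap k)" .
    have eq: "3 * (volume (serve q c D) - volume D) + (s c - s q) = 2 * costR D q c"
      unfolding v telescope[OF less_imp_le[OF 3], symmetric] sum_distrib_left sum.distrib[symmetric]
      by (intro sum.cong) (auto simp: right_rate_def)
    have "costR D q c \<le> 2 * \<bar>s p - s q\<bar>"
    proof (cases "q < p")
      case True
      then have "c \<le> p" using used assms(4) by (meson atLeastLessThan_iff less_imp_le not_le subsetD)
      then have "s c \<le> s p" using assms s_mono by auto
      then show ?thesis using leR[OF 3 c(1)] s_mono[of q c] 3 c by simp
    next
      case False
      moreover have "q \<in> U" using used 3 by auto
      ultimately have "p < q" using assms(4) by (metis linorder_neqE_nat)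
      then have "costR D q c \<le> costL D p q" using le assms(4) by blast
      then show ?thesis using leL[OF \<open>p < q\<close>] abs_ge_minus_self[of "s p - s q"] by simp
    qed
    with eq s_mono[of q c] 3 c show ?thesis by simp
  qed
qed

end
end

section \<open>Discrepancies and the offline matching\<close>

text \<open>A discrete rising sun lemma. By induction, each sum of \<open>w\<close> over an interval
  \<open>{a..<j}\<close> is at most the sum over the part of \<open>M\<close> below
  \<open>j\<close>. So \<open>M\<close> has nonnegative total weight, that is, at least a third of
  its length lies in \<open>A\<close>.\<close>

lemma rising_sun_left:
  fixes g :: "nat \<Rightarrow> real" and A :: "nat set"
  assumes "\<And>k. k < N \<Longrightarrow> 0 \<le> g k"
  defines "M \<equiv> {k. k < N \<and> (\<exists>a\<le>k. 0 \<le> (\<Sum>j=a..<Suc k. (if j \<in> A then 2 else - 1) * g j))}"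
  shows "(\<Sum>k\<in>M. g k) \<le> 3 * (\<Sum>k\<in>A \<inter> {..<N}. g k)"
proof -
  define w where "w j = (if j \<in> A then 2 else - 1) * g j" for j
  have finM: "finite M" by (simp add: M_def)
  have M_iff: "k \<in> M \<longleftrightarrow> k < N \<and> (\<exists>a\<le>k. 0 \<le> sum w {a..<Suc k})" for k
    by (simp add: M_def w_def del: sum.op_ivl_Suc)
  have "\<forall>a\<le>j. sum w {a..<j} \<le> sum w (M \<inter> {..<j})" if "j \<le> N" for j
    using that
  proof (induction j)
    case (Suc j)
    have IH: "sum w {a..<j} \<le> sum w (M \<inter> {..<j})" if "a \<le> j" for a
      using Suc that by auto
    show ?case
    proof (cases "j \<in> M")
      case True
      then have "M \<inter> {..<Suc j} = insert j (M \<inter> {..<j})" by auto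
      then have eq: "sum w (M \<inter> {..<Suc j}) = w j + sum w (M \<inter> {..<j})" by simp
      have le: "sum w {a..<Suc j} \<le> sum w (M \<inter> {..<Suc j})" if "a \<le> j" for a
        using IH[OF that] eq that by simp
      obtain a where "a \<le> j" "0 \<le> sum w {a..<Suc j}"
        using True unfolding M_iff by blast
      with le have "0 \<le> sum w (M \<inter> {..<Suc j})" by fastforce
      with le show ?thesis by (auto simp: le_Suc_eq)
    next
      case False
      then have eq: "M \<inter> {..<Suc j} = M \<inter> {..<j}" by (auto simp: less_Suc_eq)
      have "0 \<le> sum w (M \<inter> {..<j})" using IH[of j] by simp
      moreover have "sum w {a..<Suc j} < 0" if "a \<le> j" for a
        using False that Suc.prems unfolding M_iff by (meson Suc_le_lessD not_le)
      ultimately show ?thesis unfolding eq by (fastforce simp: le_Suc_eq)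
    qed
  qed simp
  from this[of N] have "0 \<le> sum w (M \<inter> {..<N})" by auto
  also have "M \<inter> {..<N} = M" by (auto simp: M_def)
  also have "sum w M = (\<Sum>k\<in>M. 3 * (if k \<in> A then g k else 0) - g k)"
    by (intro sum.cong) (auto simp: w_def)
  also have "\<dots> = 3 * (\<Sum>k\<in>M \<inter> A. g k) - (\<Sum>k\<in>M. g k)"
    using finM by (simp add: sum_subtractf sum.inter_restrict flip: sum_distrib_left)
  also have "(\<Sum>k\<in>M \<inter> A. g k) \<le> (\<Sum>k\<in>A \<inter> {..<N}. g k)"
    using assms by (intro sum_mono2) (auto simp: M_def)
  finally show ?thesis by simp
qed

text \<open>Mirror image of \<open>rising_sun_left\<close>, by induction from the right end.\<close>

lemma rising_sun_right:
  fixes g :: "nat \<Rightarrow> real" and A :: "nat set"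
  assumes "\<And>k. k < N \<Longrightarrow> 0 \<le> g k"
  defines "M \<equiv> {k. k < N \<and> (\<exists>b>k. b \<le> N \<and> 0 \<le> (\<Sum>j=k..<b. (if j \<in> A then 2 else - 1) * g j))}"
  shows "(\<Sum>k\<in>M. g k) \<le> 3 * (\<Sum>k\<in>A \<inter> {..<N}. g k)"
proof -
  define w where "w j = (if j \<in> A then 2 else - 1) * g j" for j
  have finM: "finite M" by (simp add: M_def)
  have M_iff: "k \<in> M \<longleftrightarrow> k < N \<and> (\<exists>b>k. b \<le> N \<and> 0 \<le> sum w {k..<b})" for k
    by (simp add: M_def w_def)
  have "\<forall>b. j \<le> b \<longrightarrow> b \<le> N \<longrightarrow> sum w {j..<b} \<le> sum w (M \<inter> {j..<N})" if "j \<le> N" for j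
    using that
  proof (induction rule: inc_induct)
    case (step j)
    have IH: "sum w {Suc j..<b} \<le> sum w (M \<inter> {Suc j..<N})" if "Suc j \<le> b" "b \<le> N" for b
      using step that by auto
    show ?case
    proof (cases "j \<in> M")
      case True
      then have "M \<inter> {j..<N} = insert j (M \<inter> {Suc j..<N})" using step by auto
      then have eq: "sum w (M \<inter> {j..<N}) = w j + sum w (M \<inter> {Suc j..<N})" by simp
      have le: "sum w {j..<b} \<le> sum w (M \<inter> {j..<N})" if "j < b" "b \<le> N" for b
        using IH[of b] eq that by (simp add: sum.atLeast_Suc_lessThan)
      obtain b where "j < b" "b \<le> N" "0 \<le> sum w {j..<b}"
        using True unfolding M_iff by blast
      with le have "0 \<le> sum w (M \<inter> {j..<N})" by fastforce
      with le show ?thesis by (auto simp: le_less)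
    next
      case False
      then have eq: "M \<inter> {j..<N} = M \<inter> {Suc j..<N}" by (auto simp: le_less Suc_le_eq)
      have "0 \<le> sum w (M \<inter> {Suc j..<N})" using IH[of "Suc j"] step by simp
      moreover have "sum w {j..<b} < 0" if "j < b" "b \<le> N" for b
        using False that step unfolding M_iff by (meson not_le)
      ultimately show ?thesis unfolding eq by (fastforce simp: le_less)
    qed
  qed auto
  from this[of 0] have "0 \<le> sum w (M \<inter> {0..<N})" by auto
  also have "M \<inter> {0..<N} = M" by (auto simp: M_def)
  also have "sum w M = (\<Sum>k\<in>M. 3 * (if k \<in> A then g k else 0) - g k)"
    by (intro sum.cong) (auto simp: w_def)
  also have "\<dots> = 3 * (\<Sum>k\<in>M \<inter> A. g k) - (\<Sum>k\<in>M. g k)"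
    using finM by (simp add: sum_subtractf sum.inter_restrict flip: sum_distrib_left)
  also have "(\<Sum>k\<in>M \<inter> A. g k) \<le> (\<Sum>k\<in>A \<inter> {..<N}. g k)"
    using assms by (intro sum_mono2) (auto simp: M_def)
  finally show ?thesis by simp
qed

text \<open>The last hypothesis is a weak-type bound: it makes the \<open>k\<close>-th largest value
  at most \<open>B / k\<close>. The induction removes a smallest element, which is at most
  \<open>B\<close> divided by the number of elements.\<close>

lemma sum_le_harmonic:
  fixes v :: "nat \<Rightarrow> real"
  assumes "finite E" "\<And>i. i \<in> E \<Longrightarrow> 0 \<le> v i" "0 \<le> B"
    "\<And>x. 0 < x \<Longrightarrow> real (card {i \<in> E. x \<le> v i}) * x \<le> B"
  shows "(\<Sum>i\<in>E. v i) \<le> B * (\<Sum>k=1..card E. 1 / real k)"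
  using assms
proof (induction "card E" arbitrary: E)
  case 0
  then show ?case by simp
next
  case (Suc m)
  then have E: "finite E" "E \<noteq> {}" "card E = Suc m" by auto
  obtain e where e: "e \<in> E" "\<And>i. i \<in> E \<Longrightarrow> v e \<le> v i"
    using E by (metis arg_min_if_finite(1) arg_min_least)
  have ve: "v e \<le> B / real (Suc m)"
  proof (cases "v e > 0")
    case True
    have "{i \<in> E. v e \<le> v i} = E" using e by auto
    with Suc.prems(4)[OF True] E show ?thesis by (simp add: field_simps)
  next
    case False
    moreover have "0 \<le> B / real (Suc m)" using Suc.prems(3) by simp
    ultimately show ?thesis by linarith
  qed
  have "(\<Sum>i\<in>E - {e}. v i) \<le> B * (\<Sum>k=1..card (E - {e}). 1 / real k)"
  proof (rule Suc.hyps(1))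
    show "real (card {i \<in> E - {e}. x \<le> v i}) * x \<le> B" if "0 < x" for x
    proof -
      have "card {i \<in> E - {e}. x \<le> v i} \<le> card {i \<in> E. x \<le> v i}"
        using E by (intro card_mono) auto
      then have "real (card {i \<in> E - {e}. x \<le> v i}) * x \<le> real (card {i \<in> E. x \<le> v i}) * x"
        using that by (intro mult_right_mono) auto
      with Suc.prems(4)[OF that] show ?thesis by linarith
    qed
  qed (use Suc.prems E e in auto)
  moreover have "(\<Sum>i\<in>E. v i) = v e + (\<Sum>i\<in>E - {e}. v i)"
    using E e by (simp add: sum.remove)
  moreover have "card (E - {e}) = m" using E e by simp
  ultimately show ?case using ve E(3) by (simp add: distrib_left)
qed

lemma harmonic_le: "1 \<le> n \<Longrightarrow> (\<Sum>k=1..n. 1 / real k) \<le> 1 + ln (real n)"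
proof (induction n rule: nat_induct_at_least)
  case (Suc n)
  have "ln (real n / real (Suc n)) \<le> real n / real (Suc n) - 1"
    using Suc by (intro ln_le_minus_one) auto
  then have "1 / real (Suc n) \<le> ln (real (Suc n)) - ln (real n)"
    using Suc by (simp add: ln_div field_simps)
  with Suc show ?case by simp
qed simp

section \<open>Counting functions and discrepancies\<close>

definition cnt :: "(nat \<Rightarrow> nat) \<Rightarrow> nat \<Rightarrow> nat \<Rightarrow> int" where
  "cnt c i k = (\<Sum>l<i. of_bool (c l \<le> k))"

text \<open>For chosen servers \<open>c\<close> and requests \<open>q\<close> this is the flow
  \<open>D\<close> after \<open>i\<close> rounds; for an offline matching in place of
  \<open>c\<close> it is the offline flow.\<close>

definition disc :: "(nat \<Rightarrow> nat) \<Rightarrow> (nat \<Rightarrow> nat) \<Rightarrow> nat \<Rightarrow> nat \<Rightarrow> int" where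
  "disc c q i k = cnt c i k - cnt q i k"

lemma disc_Suc: "disc c q (Suc i) = serve (q i) (c i) (disc c q i)"
  by (auto simp: disc_def serve_def cnt_def)

lemma cnt_card:
  assumes "inj_on c {..<i}"
  shows "cnt c i k = int (card (c ` {..<i} \<inter> {..k}))"
proof -
  have "c ` {..<i} \<inter> {..k} = c ` {l. l < i \<and> c l \<le> k}" by auto
  moreover have "inj_on c {l. l < i \<and> c l \<le> k}" using assms by (rule inj_on_subset) auto
  ultimately have "card (c ` {..<i} \<inter> {..k}) = card {l. l < i \<and> c l \<le> k}"
    by (simp add: card_image)
  also have "int \<dots> = cnt c i k"
    by (simp add: cnt_def of_bool_def sum.If_cases Int_def)
  finally show ?thesis by simp
qed

lemma cnt_le: "inj_on c {..<i} \<Longrightarrow> cnt c i k \<le> int (Suc k)"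
  unfolding cnt_card using card_mono[of "{..k}" "c ` {..<i} \<inter> {..k}"] by simp

lemma cnt_full:
  assumes "inj_on c {..<i}" "{..k} \<subseteq> c ` {..<i}"
  shows "cnt c i k = int (Suc k)"
proof -
  have "c ` {..<i} \<inter> {..k} = {..k}" using assms by auto
  then show ?thesis using assms by (simp add: cnt_card)
qed

lemma cnt_add:
  assumes "inj_on c {..<i}" "k' \<le> k"
  shows "cnt c i k = cnt c i k' + int (card (c ` {..<i} \<inter> {k'<..k}))"
proof -
  have "c ` {..<i} \<inter> {..k} = (c ` {..<i} \<inter> {..k'}) \<union> (c ` {..<i} \<inter> {k'<..k})" using assms by auto
  also have "card \<dots> = card (c ` {..<i} \<inter> {..k'}) + card (c ` {..<i} \<inter> {k'<..k})"
    by (intro card_Un_disjoint) auto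
  finally show ?thesis using assms by (simp add: cnt_card)
qed

text \<open>Between \<open>k'\<close> and \<open>k\<close> the matching \<open>c\<close> has used
  every server, and \<open>p\<close> cannot have used more.\<close>

lemma cnt_diff_mono:
  assumes "inj_on c {..<i}" "inj_on p {..<i}" "k' \<le> k" "{k'<..k} \<subseteq> c ` {..<i}"
  shows "cnt p i k - cnt c i k \<le> cnt p i k' - cnt c i k'"
proof -
  have "c ` {..<i} \<inter> {k'<..k} = {k'<..k}" using assms by auto
  moreover have "card (p ` {..<i} \<inter> {k'<..k}) \<le> card {k'<..k}" by (intro card_mono) auto
  ultimately show ?thesis using assms by (simp add: cnt_add[of _ i k' k])
qed

section \<open>Runs of the robust algorithm against an offline matching\<close>

locale robust_run =
  fixes s :: "nat \<Rightarrow> real" and n :: nat and q c :: "nat \<Rightarrow> nat"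
  assumes s_le: "\<And>k. Suc k < n \<Longrightarrow> s k \<le> s (Suc k)"
    and q_less: "\<And>i. i < n \<Longrightarrow> q i < n"
    and c_eq: "\<And>i. i < n \<Longrightarrow> c i = robust_choice s n (c ` {..<i}) (disc c q i) (q i)"
begin

lemma s_mono_le: "i \<le> j \<Longrightarrow> j < n \<Longrightarrow> s i \<le> s j"
  using s_mono[of n s i j] s_le by blast

lemma run:
  assumes "i \<le> n"
  shows "stableL s n (c ` {..<i}) (disc c q i) \<and> stableR s n (c ` {..<i}) (disc c q i) \<and>
    inj_on c {..<i} \<and> c ` {..<i} \<subseteq> {..<n} \<and> (\<forall>l<i. choice_ok s n (c ` {..<l}) (disc c q l) (q l) (c l))"
  using assms
proof (induction i)
  case 0
  have "0 \<le> (\<Sum>k=a..<u. left_rate 0 * (s (Suc k) - s k))" "0 \<le> (\<Sum>k=a..<u. right_rate 0 * (s (Suc k) - s k))" if "u < n" for a u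
    using that s_le by (auto intro!: sum_nonneg simp: left_rate_def right_rate_def)
  then show ?case by (simp add: stableL_def stableR_def disc_def cnt_def)
next
  case (Suc i)
  let ?U = "c ` {..<i}"
  have IH: "stableL s n ?U (disc c q i)" "stableR s n ?U (disc c q i)" "inj_on c {..<i}" "?U \<subseteq> {..<n}"
    "\<forall>l<i. choice_ok s n (c ` {..<l}) (disc c q l) (q l) (c l)" using Suc by auto
  have "card ?U < card {..<n}" using IH Suc.prems by (simp add: card_image)
  then have "\<not> {..<n} \<subseteq> ?U" by (metis card_mono finite_imageI finite_lessThan not_le)
  then have ok: "choice_ok s n ?U (disc c q i) (q i) (c i)"
    using IH Suc.prems q_less by (subst c_eq) (auto intro!: choice_ok_robust_choice)
  then have "c i < n" "c i \<notin> ?U" by (auto simp: choice_ok_def)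
  moreover have "c ` {..<Suc i} = insert (c i) ?U" by (auto simp: lessThan_Suc)
  ultimately show ?case
    using IH ok Suc.prems q_less stableL_serve[OF s_le IH(1,2) _ ok] stableR_serve[OF s_le IH(1,2) _ ok]
    by (auto simp: disc_Suc lessThan_Suc less_Suc_eq)
qed

lemma inj_c: "i \<le> n \<Longrightarrow> inj_on c {..<i}"
  using run by blast

lemma c_ok: "i < n \<Longrightarrow> choice_ok s n (c ` {..<i}) (disc c q i) (q i) (c i)"
  using run[of n] by simp

lemma c_fresh: "i < n \<Longrightarrow> c i \<notin> c ` {..<i}"
  using c_ok unfolding choice_ok_def by simp

lemma c_less: "i < n \<Longrightarrow> c i < n"
  using run[of n] by auto

context
  fixes p :: "nat \<Rightarrow> nat"
  assumes inj_p: "inj_on p {..<n}" and p_less: "\<And>i. i < n \<Longrightarrow> p i < n"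
begin

definition crossings :: "nat \<Rightarrow> nat" where
  "crossings k = card {l. l < n \<and> (p l \<le> k) \<noteq> (q l \<le> k)}"

lemma abs_disc_off:
  assumes "i \<le> n"
  shows "\<bar>disc p q i k\<bar> \<le> int (crossings k)"
proof -
  have "\<bar>disc p q i k\<bar> = \<bar>\<Sum>l<i. of_bool (p l \<le> k) - of_bool (q l \<le> k)\<bar>"
    by (simp add: disc_def cnt_def sum_subtractf)
  also have "\<dots> \<le> (\<Sum>l<i. \<bar>of_bool (p l \<le> k) - of_bool (q l \<le> k)\<bar>)" by (rule sum_abs)
  also have "\<dots> = (\<Sum>l<i. of_bool ((p l \<le> k) \<noteq> (q l \<le> k)))"
    by (intro sum.cong) (auto simp: of_bool_def)
  also have "\<dots> = int (card {l. l < i \<and> (p l \<le> k) \<noteq> (q l \<le> k)})"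
    by (simp add: of_bool_def sum.If_cases Int_def)
  also have "\<dots> \<le> int (crossings k)"
    unfolding crossings_def of_nat_le_iff using assms by (intro card_mono) auto
  finally show ?thesis .
qed

text \<open>
  If the discrepancy at a gap reaches \<open>m\<close> at any time while few offline edges cross
  the gap, then the offline matching uses a server on one side that is still free for the
  algorithm, and stability shows that busy gaps make up a third of the way to it. The resulting
  sets do not depend on the time.
\<close>

definition busy :: "nat \<Rightarrow> nat set" where
  "busy m = {k. m \<le> 2 * crossings k}"

definition sunL :: "nat \<Rightarrow> nat set" where
  "sunL m = {k. k < n - 1 \<and> (\<exists>a\<le>k. 0 \<le> (\<Sum>j=a..<Suc k. (if j \<in> busy m then 2 else - 1) * (s (Suc j) - s j)))}"

definition sunR :: "nat \<Rightarrow> nat set" where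
  "sunR m = {k. k < n - 1 \<and> (\<exists>b>k. b \<le> n - 1 \<and> 0 \<le> (\<Sum>j=k..<b. (if j \<in> busy m then 2 else - 1) * (s (Suc j) - s j)))}"

lemma disc_sunL:
  assumes "i \<le> n" "Suc k < n" "disc c q i k \<le> - int m"
  shows "k \<in> sunL m"
proof (cases "k \<in> busy m")
  case True
  then show ?thesis using assms s_le unfolding sunL_def by (auto intro!: exI[of _ k])
next
  case False
  let ?U = "c ` {..<i}"
  have inj: "inj_on c {..<i}" "inj_on p {..<i}"
    using inj_c[OF assms(1)] inj_on_subset[OF inj_p] assms(1) by auto
  \<comment> \<open>At a gap that is not busy the offline flow is below \<open>m / 2\<close> in
    absolute value, so up to \<open>k\<close> the matching \<open>p\<close> has used over
    \<open>m / 2\<close> servers more than the algorithm.\<close>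
  have gt: "int m < 2 * (cnt p i k - cnt c i k)"
    using False assms(3) abs_disc_off[OF assms(1), of k] by (auto simp: busy_def disc_def)
  \<comment> \<open>Hence some server up to \<open>k\<close> is free for the algorithm;
    \<open>a\<close> is the nearest one.\<close>
  define a where "a = Max {a. a \<le> k \<and> a \<notin> ?U}"
  have "\<not> {..k} \<subseteq> ?U" using cnt_full[OF inj(1), of k] cnt_le[OF inj(2), of k] gt by auto
  then have "a \<in> {a. a \<le> k \<and> a \<notin> ?U}" unfolding a_def by (intro Max_in) auto
  moreover have le_a: "z \<le> a" if "z \<le> k" "z \<notin> ?U" for z
    unfolding a_def using that by (intro Max_ge) auto
  ultimately have a: "a \<le> k" "a \<notin> ?U" "{a<..k} \<subseteq> ?U" by force+
  have "0 \<le> costL s (disc c q i) a (Suc k)"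
    using run[OF assms(1)] a assms(2) unfolding stableL_def by (meson le_Suc_eq)
  also have "\<dots> \<le> (\<Sum>j=a..<Suc k. (if j \<in> busy m then 2 else - 1) * (s (Suc j) - s j))"
  proof (intro sum_mono mult_right_mono)
    fix j assume j: "j \<in> {a..<Suc k}"
    show "0 \<le> s (Suc j) - s j" using s_le[of j] j assms(2) by auto
    \<comment> \<open>The surplus of \<open>p\<close> at \<open>k\<close> persists at
      \<open>j\<close>, since all servers in between are used. If \<open>j\<close> is not busy, this
      makes the flow of the algorithm negative there, hence the rate is - 1.\<close>
    have "cnt p i k - cnt c i k \<le> cnt p i j - cnt c i j"
      using inj j a by (intro cnt_diff_mono) auto
    then show "left_rate (disc c q i j) \<le> (if j \<in> busy m then 2 else - 1)"
      using gt abs_disc_off[OF assms(1), of j] by (auto simp: left_rate_def disc_def busy_def)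
  qed
  finally show ?thesis using a assms(2) unfolding sunL_def by (auto simp del: sum.op_ivl_Suc)
qed

lemma disc_sunR:
  assumes "i \<le> n" "Suc k < n" "int m \<le> disc c q i k"
  shows "k \<in> sunR m"
proof (cases "k \<in> busy m")
  case True
  then show ?thesis using assms s_le unfolding sunR_def by (auto intro!: exI[of _ "Suc k"])
next
  case False
  let ?U = "c ` {..<i}"
  have inj: "inj_on c {..<i}" "inj_on p {..<i}"
    using inj_c[OF assms(1)] inj_on_subset[OF inj_p] assms(1) by auto
  have gt: "int m < 2 * (cnt c i k - cnt p i k)"
    using False assms(3) abs_disc_off[OF assms(1), of k] by (auto simp: busy_def disc_def)
  \<comment> \<open>Up to the last position both matchings have used exactly \<open>i\<close>
    servers. This turns the deficit of \<open>p\<close> left of the gap into a free server right of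
    it.\<close>
  have all: "cnt f i (n - 1) = int i" if "\<And>l. l < n \<Longrightarrow> f l < n" for f
  proof -
    have "f l \<le> n - 1" if "l < i" for l using \<open>\<And>l. l < n \<Longrightarrow> f l < n\<close>[of l] that assms(1) by auto
    then have "cnt f i (n - 1) = (\<Sum>l<i. 1)" unfolding cnt_def by (intro sum.cong) auto
    then show ?thesis by simp
  qed
  define b where "b = Min {b. k < b \<and> b < n \<and> b \<notin> ?U}"
  have "\<not> {k<..n - 1} \<subseteq> ?U"
  proof
    assume "{k<..n - 1} \<subseteq> ?U"
    then have "cnt p i (n - 1) - cnt c i (n - 1) \<le> cnt p i k - cnt c i k"
      using inj assms(2) by (intro cnt_diff_mono) auto
    then show False using gt all[of p] all[of c] p_less c_less by auto
  qed
  then have "b \<in> {b. k < b \<and> b < n \<and> b \<notin> ?U}"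
    unfolding b_def using assms(2) by (intro Min_in) force+
  moreover have b_le: "b \<le> z" if "k < z" "z < n" "z \<notin> ?U" for z
    unfolding b_def using that by (intro Min_le) auto
  ultimately have b: "k < b" "b < n" "b \<notin> ?U" "\<And>z. k < z \<Longrightarrow> z < b \<Longrightarrow> z \<in> ?U" by force+
  have "0 \<le> costR s (disc c q i) k b"
    using run[OF assms(1)] b unfolding stableR_def by (meson less_imp_le)
  also have "\<dots> \<le> (\<Sum>j=k..<b. (if j \<in> busy m then 2 else - 1) * (s (Suc j) - s j))"
  proof (intro sum_mono mult_right_mono)
    fix j assume j: "j \<in> {k..<b}"
    show "0 \<le> s (Suc j) - s j" using s_le[of j] j b(2) by auto
    have "cnt p i j - cnt c i j \<le> cnt p i k - cnt c i k"
      using inj j b(4) by (intro cnt_diff_mono) auto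
    then show "right_rate (disc c q i j) \<le> (if j \<in> busy m then 2 else - 1)"
      using gt abs_disc_off[OF assms(1), of j] by (auto simp: right_rate_def disc_def busy_def)
  qed
  finally show ?thesis using b assms(2) by (auto simp: sunR_def intro!: exI[of _ b])
qed

text \<open>A majorant of the absolute discrepancy at gap \<open>k\<close> that does not depend on
  the time, counted level by level.\<close>

definition height :: "nat \<Rightarrow> real" where
  "height k = (\<Sum>m=1..n. of_bool (k \<in> sunL m) + of_bool (k \<in> sunR m))"

text \<open>Each level from 1 up to the absolute discrepancy contributes at least 1, by
  \<open>disc_sunL\<close> or \<open>disc_sunR\<close>. A discrepancy never exceeds the number of
  rounds, so \<open>n\<close> levels are enough.\<close>

lemma abs_disc_le_height:
  assumes "i \<le> n" "Suc k < n"
  shows "\<bar>real_of_int (disc c q i k)\<bar> \<le> height k"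
proof -
  define d where "d = nat \<bar>disc c q i k\<bar>"
  have "\<bar>disc c q i k\<bar> \<le> (\<Sum>l<i. \<bar>of_bool (c l \<le> k) - of_bool (q l \<le> k)\<bar>)"
    unfolding disc_def cnt_def sum_subtractf[symmetric] by (rule sum_abs)
  also have "\<dots> \<le> (\<Sum>l<i. 1)" by (intro sum_mono) (auto simp: of_bool_def)
  finally have "d \<le> n" using assms by (simp add: d_def)
  have "k \<in> sunL m \<or> k \<in> sunR m" if "m \<in> {1..d}" for m
    using that disc_sunL[OF assms, of m] disc_sunR[OF assms, of m] by (force simp: d_def)
  then have "real d \<le> (\<Sum>m=1..d. of_bool (k \<in> sunL m) + of_bool (k \<in> sunR m))"
    using sum_mono[of "{1..d}" "\<lambda>_. 1::real" "\<lambda>m. of_bool (k \<in> sunL m) + of_bool (k \<in> sunR m)"]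
    by (force simp: of_bool_def)
  also have "\<dots> \<le> height k"
    unfolding height_def using \<open>d \<le> n\<close> by (intro sum_mono2) auto
  finally show ?thesis by (simp add: d_def)
qed

lemma dist_eq_crossings:
  assumes "a < n" "b < n"
  shows "\<bar>s a - s b\<bar> = (\<Sum>k<n - 1. of_bool ((a \<le> k) \<noteq> (b \<le> k)) * (s (Suc k) - s k))"
proof -
  have *: "s b - s a = (\<Sum>k<n - 1. of_bool ((a \<le> k) \<noteq> (b \<le> k)) * (s (Suc k) - s k))"
    if "a \<le> b" "b < n" for a b
  proof -
    have "s b - s a = (\<Sum>k=a..<b. s (Suc k) - s k)" using that by (simp add: sum_Suc_diff')
    also have "\<dots> = (\<Sum>k\<in>{a..<b}. of_bool ((a \<le> k) \<noteq> (b \<le> k)) * (s (Suc k) - s k))"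
      by (intro sum.cong) auto
    also have "\<dots> = (\<Sum>k<n - 1. of_bool ((a \<le> k) \<noteq> (b \<le> k)) * (s (Suc k) - s k))"
      using that by (intro sum.mono_neutral_left) auto
    finally show ?thesis .
  qed
  show ?thesis
  proof (cases "a \<le> b")
    case True
    then show ?thesis using *[OF True assms(2)] s_mono_le[OF True assms(2)] by auto
  next
    case False
    then have "b \<le> a" by simp
    from *[OF this assms(1)] s_mono_le[OF this assms(1)] show ?thesis by (auto simp: eq_commute)
  qed
qed

lemma sum_crossings:
  "(\<Sum>k<n - 1. real (crossings k) * (s (Suc k) - s k)) = (\<Sum>l<n. \<bar>s (p l) - s (q l)\<bar>)"
proof -
  have "(\<Sum>l<n. \<bar>s (p l) - s (q l)\<bar>) =
      (\<Sum>l<n. \<Sum>k<n - 1. of_bool ((p l \<le> k) \<noteq> (q l \<le> k)) * (s (Suc k) - s k))"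
    using p_less q_less by (intro sum.cong dist_eq_crossings) auto
  also have "\<dots> = (\<Sum>k<n - 1. (\<Sum>l<n. of_bool ((p l \<le> k) \<noteq> (q l \<le> k))) * (s (Suc k) - s k))"
    by (subst sum.swap) (simp add: sum_distrib_right)
  also have "\<dots> = (\<Sum>k<n - 1. real (crossings k) * (s (Suc k) - s k))"
    by (simp add: crossings_def of_bool_def sum.If_cases Int_def)
  finally show ?thesis by simp
qed

text \<open>At each level the two sun sets together have at most 6 times the length of the busy
  gaps. A gap is busy at no more than \<open>2 * crossings k\<close> levels, which gives 12.\<close>

lemma sum_height:
  "(\<Sum>k<n - 1. height k * (s (Suc k) - s k)) \<le> 12 * (\<Sum>l<n. \<bar>s (p l) - s (q l)\<bar>)"
proof -
  let ?g = "\<lambda>k. s (Suc k) - s k"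
  have g: "0 \<le> ?g k" if "k < n - 1" for k using s_le[of k] that by auto
  have layer: "(\<Sum>k<n - 1. (of_bool (k \<in> sunL m) + of_bool (k \<in> sunR m)) * ?g k)
      \<le> 6 * (\<Sum>k<n - 1. of_bool (k \<in> busy m) * ?g k)" for m
  proof -
    have eq: "(\<Sum>k<n - 1. of_bool (k \<in> M) * ?g k) = (\<Sum>k\<in>{..<n - 1} \<inter> M. ?g k)" for M
      by (simp add: of_bool_def if_distrib[of "\<lambda>x. x * _"] sum.If_cases cong: if_cong)
    have "{..<n - 1} \<inter> sunL m = sunL m" "{..<n - 1} \<inter> sunR m = sunR m"
      by (auto simp: sunL_def sunR_def)
    moreover have "(\<Sum>k\<in>sunL m. ?g k) \<le> 3 * (\<Sum>k\<in>busy m \<inter> {..<n - 1}. ?g k)"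
      unfolding sunL_def by (intro rising_sun_left g)
    moreover have "(\<Sum>k\<in>sunR m. ?g k) \<le> 3 * (\<Sum>k\<in>busy m \<inter> {..<n - 1}. ?g k)"
      unfolding sunR_def by (intro rising_sun_right g)
    ultimately show ?thesis by (simp add: distrib_right sum.distrib eq Int_commute[of "busy m"])
  qed
  have "(\<Sum>k<n - 1. height k * ?g k) =
      (\<Sum>m=1..n. \<Sum>k<n - 1. (of_bool (k \<in> sunL m) + of_bool (k \<in> sunR m)) * ?g k)"
    unfolding height_def sum_distrib_right by (rule sum.swap)
  also have "\<dots> \<le> (\<Sum>m=1..n. 6 * (\<Sum>k<n - 1. of_bool (k \<in> busy m) * ?g k))"
    by (intro sum_mono layer)
  also have "\<dots> = 6 * (\<Sum>k<n - 1. (\<Sum>m=1..n. of_bool (k \<in> busy m)) * ?g k)"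
    unfolding sum_distrib_left[symmetric] sum_distrib_right by (subst sum.swap) simp
  also have "\<dots> \<le> 6 * (\<Sum>k<n - 1. (2 * real (crossings k)) * ?g k)"
  proof (intro mult_left_mono sum_mono mult_right_mono)
    fix k assume "k \<in> {..<n - 1}"
    then show "0 \<le> ?g k" using g by auto
    have "(\<Sum>m=1..n. of_bool (k \<in> busy m)) = real (card ({1..n} \<inter> {m. m \<le> 2 * crossings k}))"
      by (simp add: of_bool_def sum.If_cases busy_def)
    also have "\<dots> \<le> real (card {1..2 * crossings k})"
      unfolding of_nat_le_iff by (intro card_mono) auto
    finally show "(\<Sum>m=1..n. of_bool (k \<in> busy m)) \<le> 2 * real (crossings k)" by simp
  qed simp
  also have "\<dots> = 12 * (\<Sum>k<n - 1. real (crossings k) * ?g k)"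
    by (simp add: sum_distrib_left mult_ac)
  finally show ?thesis unfolding sum_crossings .
qed

end
end

section \<open>Requests far from free servers\<close>

text \<open>A bump for cell \<open>j\<close> of width \<open>d\<close>: at least 1 / 2 on the cell,
  and 0 from distance \<open>d\<close> to its centre on. Unlike an indicator function it has slope
  at most \<open>1 / d\<close>, so short gaps contribute little.\<close>

definition tent :: "real \<Rightarrow> int \<Rightarrow> real \<Rightarrow> real" where
  "tent d j z = max 0 (1 - \<bar>z / d - of_int j - 1 / 2\<bar>)"

lemma tent_diff_le:
  assumes "0 < d" "z \<le> z'"
  shows "\<bar>tent d j z' - tent d j z\<bar> \<le> (z' - z) / d"
proof -
  have "\<bar>max 0 (1 - \<bar>a\<bar>) - max 0 (1 - \<bar>b\<bar>)\<bar> \<le> \<bar>a - b\<bar>" for a b :: real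
    by linarith
  from this[of "z' / d - of_int j - 1 / 2" "z / d - of_int j - 1 / 2"]
  have "\<bar>tent d j z' - tent d j z\<bar> \<le> \<bar>z' / d - z / d\<bar>"
    unfolding tent_def by simp
  also have "\<dots> = (z' - z) / d" using assms by (simp add: diff_divide_distrib[symmetric])
  finally show ?thesis .
qed

lemma tent_nonzero:
  assumes "tent d j z \<noteq> 0"
  shows "j \<in> {\<lfloor>z / d - 1 / 2\<rfloor>, \<lceil>z / d - 1 / 2\<rceil>}"
proof -
  define u where "u = z / d - 1 / 2"
  have "\<bar>u - of_int j\<bar> < 1" using assms by (auto simp: tent_def u_def max_def split: if_splits)
  then have "j = \<lfloor>u\<rfloor> \<or> j = \<lceil>u\<rceil>" by linarith
  then show ?thesis by (simp add: u_def)
qed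

text \<open>At most two tents are nonzero at each of the two points, so at most four terms
  remain.\<close>

lemma sum_tent_diff_le:
  assumes "0 < d" "z \<le> z'" "finite J"
  shows "(\<Sum>j\<in>J. \<bar>tent d j z' - tent d j z\<bar>) \<le> 4 * ((z' - z) / d)"
proof -
  define B where "B = {\<lfloor>z / d - 1 / 2\<rfloor>, \<lceil>z / d - 1 / 2\<rceil>, \<lfloor>z' / d - 1 / 2\<rfloor>, \<lceil>z' / d - 1 / 2\<rceil>}"
  have zero: "tent d j z = 0 \<and> tent d j z' = 0" if "j \<notin> B" for j
    using tent_nonzero[of d j z] tent_nonzero[of d j z'] that by (auto simp: B_def)
  have "(\<Sum>j\<in>J. \<bar>tent d j z' - tent d j z\<bar>) = (\<Sum>j\<in>J \<inter> B. \<bar>tent d j z' - tent d j z\<bar>)"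
    using assms(3) zero by (intro sum.mono_neutral_right) auto
  also have "\<dots> \<le> real (card (J \<inter> B)) * ((z' - z) / d)"
    using tent_diff_le[OF assms(1,2)] by (intro sum_bounded_above) auto
  also have "card (J \<inter> B) \<le> card B" by (intro card_mono) (auto simp: B_def)
  then have "real (card (J \<inter> B)) * ((z' - z) / d) \<le> real (card B) * ((z' - z) / d)"
    using assms by (intro mult_right_mono) auto
  also have "card B \<le> 4" unfolding B_def by (simp add: card_insert_if)
  then have "real (card B) * ((z' - z) / d) \<le> 4 * ((z' - z) / d)"
    using assms by (intro mult_right_mono) auto
  finally show ?thesis by simp
qed

context robust_run
begin

text \<open>Summation by parts, so that excesses of requests over used servers can be read off from
  the discrepancies.\<close>

lemma sum_disc:
  assumes "i \<le> n"
  shows "(\<Sum>l<i. Y (q l)) - (\<Sum>l<i. Y (c l)) =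
    (\<Sum>k<n - 1. (Y (Suc k) - Y k) * real_of_int (disc c q i k))"
proof -
  have Y: "Y a = Y (n - 1) - (\<Sum>k<n - 1. (Y (Suc k) - Y k) * of_bool (a \<le> k))" if "a < n" for a
  proof -
    have "(\<Sum>k<n - 1. (Y (Suc k) - Y k) * of_bool (a \<le> k)) = (\<Sum>k=a..<n - 1. (Y (Suc k) - Y k) * of_bool (a \<le> k))"
      by (intro sum.mono_neutral_right) auto
    also have "\<dots> = (\<Sum>k=a..<n - 1. Y (Suc k) - Y k)" by (intro sum.cong) auto
    also have "\<dots> = Y (n - 1) - Y a" using that by (intro sum_Suc_diff') auto
    finally show ?thesis by simp
  qed
  have tot: "(\<Sum>l<i. Y (f l)) = real i * Y (n - 1) - (\<Sum>k<n - 1. (Y (Suc k) - Y k) * real_of_int (cnt f i k))"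
    if "\<And>l. l < n \<Longrightarrow> f l < n" for f
  proof -
    have "(\<Sum>l<i. Y (f l)) = (\<Sum>l<i. Y (n - 1) - (\<Sum>k<n - 1. (Y (Suc k) - Y k) * of_bool (f l \<le> k)))"
      using that assms by (intro sum.cong Y) auto
    also have "\<dots> = real i * Y (n - 1) - (\<Sum>l<i. \<Sum>k<n - 1. (Y (Suc k) - Y k) * of_bool (f l \<le> k))"
      by (simp add: sum_subtractf)
    also have "(\<Sum>l<i. \<Sum>k<n - 1. (Y (Suc k) - Y k) * of_bool (f l \<le> k)) =
        (\<Sum>k<n - 1. (Y (Suc k) - Y k) * real_of_int (cnt f i k))"
      unfolding cnt_def of_int_sum sum_distrib_left by (subst sum.swap) simp
    finally show ?thesis .
  qed
  show ?thesis
    using tot[of q] tot[of c] q_less c_less by (simp add: disc_def right_diff_distrib sum_subtractf)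
qed

definition free_dist :: "nat \<Rightarrow> real" where
  "free_dist i = Min ((\<lambda>a. \<bar>s a - s (q i)\<bar>) ` ({..<n} - c ` {..<i}))"

lemma free_dist_le: "a < n \<Longrightarrow> a \<notin> c ` {..<i} \<Longrightarrow> free_dist i \<le> \<bar>s a - s (q i)\<bar>"
  unfolding free_dist_def by (intro Min_le) auto

lemma free_dist_attained:
  assumes "i < n"
  obtains a where "a < n" "a \<notin> c ` {..<i}" "free_dist i = \<bar>s a - s (q i)\<bar>"
proof -
  have "c i \<in> {..<n} - c ` {..<i}" using c_fresh c_less assms by auto
  then have "free_dist i \<in> (\<lambda>a. \<bar>s a - s (q i)\<bar>) ` ({..<n} - c ` {..<i})"
    unfolding free_dist_def by (intro Min_in) auto
  then show ?thesis using that by auto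
qed

text \<open>
  All servers near a far request are used. Hence the excess of requests over used servers there
  grows with every further request, and discrepancies have to account for it.
\<close>

lemma card_far_requests:
  assumes G: "\<And>i k. i \<le> n \<Longrightarrow> Suc k < n \<Longrightarrow> \<bar>real_of_int (disc c q i k)\<bar> \<le> G k" and "0 < x"
  shows "real (card {i \<in> {..<n}. x \<le> free_dist i}) * x \<le> 32 * (\<Sum>k<n - 1. G k * (s (Suc k) - s k))"
proof -
  \<comment> \<open>With this width, a point at distance \<open>x\<close> or more from a point of a
    cell is at least 3 / 2 widths away from the centre, hence outside the support of the
    tent.\<close>
  define d where "d = x / 2"
  have d: "0 < d" using assms by (simp add: d_def)
  define E where "E = {i \<in> {..<n}. x \<le> free_dist i}"
  define w where "w i = \<lfloor>s (q i) / d\<rfloor>" for i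
  have finE: "finite E" by (simp add: E_def)
  have near: "1 / 2 \<le> tent d (w i) (s (q i))" for i
    unfolding tent_def w_def by linarith
  have window: "real (card {i \<in> E. w i = j}) \<le>
      4 * (\<Sum>k<n - 1. \<bar>tent d j (s (Suc k)) - tent d j (s k)\<bar> * G k)" if "j \<in> w ` E" for j
  proof -
    define Ej where "Ej = {i \<in> E. w i = j}"
    \<comment> \<open>A server chosen in round \<open>i0\<close> or later was still free when the
      far request \<open>i0\<close> arrived, so it lies outside the tent.\<close>
    define i0 where "i0 = Min Ej"
    have "finite Ej" "Ej \<noteq> {}" using finE that by (auto simp: Ej_def)
    then have i0: "i0 \<in> Ej" "\<And>i. i \<in> Ej \<Longrightarrow> i0 \<le> i" by (auto simp: i0_def)
    then have i0n: "i0 < n" "x \<le> free_dist i0" "w i0 = j" by (auto simp: Ej_def E_def)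
    define Y where "Y k = tent d j (s k)" for k
    have Yc: "Y (c l) = 0" if "l \<in> {i0..<n}" for l
    proof -
      have "c l \<notin> c ` {..<i0}" "c l < n" using that c_fresh[of l] c_less by auto
      then have "x \<le> \<bar>s (c l) - s (q i0)\<bar>" using free_dist_le[of "c l" i0] i0n by linarith
      then have "2 \<le> \<bar>s (c l) / d - s (q i0) / d\<bar>"
        using d by (simp add: diff_divide_distrib[symmetric] abs_divide pos_le_divide_eq d_def)
      moreover have "\<bar>s (q i0) / d - of_int j - 1 / 2\<bar> \<le> 1 / 2"
        using i0n(3) unfolding w_def by linarith
      ultimately show ?thesis unfolding Y_def tent_def by linarith
    qed
    have split: "(\<Sum>l<n. Y (f l)) = (\<Sum>l<i0. Y (f l)) + (\<Sum>l\<in>{i0..<n}. Y (f l))" for f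
      using i0n sum.atLeastLessThan_concat[of 0 i0 n "\<lambda>l. Y (f l)"] by (simp add: atLeast0LessThan)
    have "real (card Ej) / 2 = (\<Sum>l\<in>Ej. 1 / 2)" by simp
    also have "\<dots> \<le> (\<Sum>l\<in>Ej. Y (q l))"
    proof (intro sum_mono)
      fix l assume "l \<in> Ej"
      then have "w l = j" by (simp add: Ej_def)
      with near[of l] show "1 / 2 \<le> Y (q l)" by (simp add: Y_def)
    qed
    also have "\<dots> \<le> (\<Sum>l\<in>{i0..<n}. Y (q l))"
      using i0(2) by (intro sum_mono2) (auto simp: Ej_def E_def Y_def tent_def)
    \<comment> \<open>As no server chosen from \<open>i0\<close> on counts, these requests fully
      show up in the change of the discrepancies between the times \<open>i0\<close> and
      \<open>n\<close>.\<close>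
    also have "\<dots> = (\<Sum>k<n - 1. (Y (Suc k) - Y k) * real_of_int (disc c q n k))
        - (\<Sum>k<n - 1. (Y (Suc k) - Y k) * real_of_int (disc c q i0 k))"
      using sum_disc[of n Y] sum_disc[of i0 Y] i0n split[of q] split[of c] Yc by simp
    also have "\<dots> = (\<Sum>k<n - 1. (Y (Suc k) - Y k) * (real_of_int (disc c q n k) - real_of_int (disc c q i0 k)))"
      by (simp add: right_diff_distrib sum_subtractf)
    also have "\<dots> \<le> (\<Sum>k<n - 1. \<bar>Y (Suc k) - Y k\<bar> * (2 * G k))"
    proof (intro sum_mono)
      fix k assume "k \<in> {..<n - 1}"
      then have "Suc k < n" by auto
      from G[OF order_refl this] G[OF less_imp_le[OF i0n(1)] this] have "\<bar>real_of_int (disc c q n k) - real_of_int (disc c q i0 k)\<bar> \<le> 2 * G k"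
        by linarith
      then have "\<bar>(Y (Suc k) - Y k) * (real_of_int (disc c q n k) - real_of_int (disc c q i0 k))\<bar>
          \<le> \<bar>Y (Suc k) - Y k\<bar> * (2 * G k)"
        unfolding abs_mult by (intro mult_left_mono) auto
      then show "(Y (Suc k) - Y k) * (real_of_int (disc c q n k) - real_of_int (disc c q i0 k))
          \<le> \<bar>Y (Suc k) - Y k\<bar> * (2 * G k)" by linarith
    qed
    also have "\<dots> = 2 * (\<Sum>k<n - 1. \<bar>Y (Suc k) - Y k\<bar> * G k)"
      by (simp add: sum_distrib_left mult_ac)
    finally show ?thesis by (simp add: Y_def Ej_def)
  qed
  have "real (card E) = (\<Sum>j\<in>w ` E. real (card {i \<in> E. w i = j}))"
    using sum.image_gen[OF finE, of "\<lambda>_. 1::real" w] by simp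
  also have "\<dots> \<le> (\<Sum>j\<in>w ` E. 4 * (\<Sum>k<n - 1. \<bar>tent d j (s (Suc k)) - tent d j (s k)\<bar> * G k))"
    by (intro sum_mono window)
  also have "\<dots> = 4 * (\<Sum>k<n - 1. (\<Sum>j\<in>w ` E. \<bar>tent d j (s (Suc k)) - tent d j (s k)\<bar>) * G k)"
    unfolding sum_distrib_left[symmetric] sum_distrib_right by (subst sum.swap) simp
  also have "\<dots> \<le> 4 * (\<Sum>k<n - 1. 4 * ((s (Suc k) - s k) / d) * G k)"
  proof (intro mult_left_mono sum_mono mult_right_mono)
    fix k assume k: "k \<in> {..<n - 1}"
    show "0 \<le> G k" using G[of n k] k by force
    show "(\<Sum>j\<in>w ` E. \<bar>tent d j (s (Suc k)) - tent d j (s k)\<bar>) \<le> 4 * ((s (Suc k) - s k) / d)"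
      using d s_le[of k] k finE by (intro sum_tent_diff_le) auto
  qed simp
  \<comment> \<open>The factors are 4 from \<open>window\<close>, 4 from the tents, and
    \<open>1 / d = 2 / x\<close>.\<close>
  also have "\<dots> = 32 * (\<Sum>k<n - 1. G k * (s (Suc k) - s k)) / x"
    by (simp add: sum_distrib_left sum_divide_distrib d_def mult_ac)
  finally show ?thesis using assms(2) by (simp add: E_def field_simps)
qed

text \<open>Sum \<open>serve_length\<close> over all rounds: the potential starts at 0 and ends
  nonnegative.\<close>

lemma run_cost_le_free_dist: "(\<Sum>i<n. \<bar>s (c i) - s (q i)\<bar>) \<le> 4 * (\<Sum>i<n. free_dist i)"
proof -
  let ?vol = "\<lambda>i. volume s n (disc c q i)"
  have "\<bar>s (c i) - s (q i)\<bar> + 3 * (?vol (Suc i) - ?vol i) \<le> 4 * free_dist i" if i: "i < n" for i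
  proof -
    obtain a where a: "a < n" "a \<notin> c ` {..<i}" "free_dist i = \<bar>s a - s (q i)\<bar>"
      using free_dist_attained[OF i] .
    from serve_length[OF s_le c_ok[OF i] q_less[OF i] a(1,2)] a(3) show ?thesis by (simp add: disc_Suc)
  qed
  then have "(\<Sum>i<n. \<bar>s (c i) - s (q i)\<bar> + 3 * (?vol (Suc i) - ?vol i)) \<le> (\<Sum>i<n. 4 * free_dist i)"
    by (intro sum_mono) auto
  moreover have "(\<Sum>i<n. ?vol (Suc i) - ?vol i) = ?vol n - ?vol 0"
    by (rule sum_lessThan_telescope)
  moreover have "?vol 0 = 0" by (simp add: volume_def disc_def cnt_def)
  moreover have "0 \<le> ?vol n" using s_le by (auto simp: volume_def intro!: sum_nonneg mult_nonneg_nonneg)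
  ultimately show ?thesis unfolding sum.distrib sum_distrib_left[symmetric] by linarith
qed

text \<open>The constant is 4 * 32 * 12, from \<open>run_cost_le_free_dist\<close>,
  \<open>card_far_requests\<close> and \<open>sum_height\<close>.\<close>

lemma run_cost:
  assumes "inj_on p {..<n}" "\<And>i. i < n \<Longrightarrow> p i < n" "1 \<le> n"
  shows "(\<Sum>i<n. \<bar>s (c i) - s (q i)\<bar>) \<le> 1536 * (1 + ln (real n)) * (\<Sum>i<n. \<bar>s (p i) - s (q i)\<bar>)"
proof -
  let ?off = "\<Sum>i<n. \<bar>s (p i) - s (q i)\<bar>"
  let ?V = "\<Sum>k<n - 1. height p k * (s (Suc k) - s k)"
  have V: "?V \<le> 12 * ?off" using sum_height[OF assms(1,2)] .
  have h: "\<bar>real_of_int (disc c q i k)\<bar> \<le> height p k" if "i \<le> n" "Suc k < n" for i k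
    using abs_disc_le_height[OF assms(1,2) that] .
  have "0 \<le> height p k" if "Suc k < n" for k
    using h[OF order_refl that] by linarith
  then have V0: "0 \<le> ?V"
    using s_le by (auto intro!: sum_nonneg mult_nonneg_nonneg)
  have "0 \<le> free_dist i" if "i < n" for i
    using free_dist_attained[OF that] by (metis abs_ge_zero)
  then have "(\<Sum>i<n. free_dist i) \<le> 32 * ?V * (\<Sum>k=1..card {..<n}. 1 / real k)"
    using V0 card_far_requests[of "height p", OF h] by (intro sum_le_harmonic) auto
  also have "\<dots> \<le> 32 * ?V * (1 + ln (real n))"
    using harmonic_le[OF assms(3)] V0 by (intro mult_left_mono) auto
  also have "\<dots> \<le> 32 * (12 * ?off) * (1 + ln (real n))"
    using V assms(3) by (intro mult_right_mono mult_left_mono) auto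
  finally show ?thesis using run_cost_le_free_dist by (simp add: algebra_simps)
qed

end

section \<open>The combined algorithm\<close>

definition server :: "real set \<Rightarrow> nat \<Rightarrow> real" where
  "server S k = sorted_list_of_set S ! k"

definition nearest :: "real set \<Rightarrow> real \<Rightarrow> nat" where
  "nearest S r = (SOME k. k < card S \<and> (\<forall>j<card S. \<bar>server S k - r\<bar> \<le> \<bar>server S j - r\<bar>))"

lemma nearest:
  assumes "0 < card S"
  shows "nearest S r < card S"
    "j < card S \<Longrightarrow> \<bar>server S (nearest S r) - r\<bar> \<le> \<bar>server S j - r\<bar>"
proof -
  have "{..<card S} \<noteq> {}" using assms by auto
  then have "\<exists>k. k < card S \<and> (\<forall>j<card S. \<bar>server S k - r\<bar> \<le> \<bar>server S j - r\<bar>)"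
    using arg_min_if_finite(1)[of "{..<card S}" "\<lambda>k. \<bar>server S k - r\<bar>"]
      arg_min_least[of "{..<card S}" _ "\<lambda>k. \<bar>server S k - r\<bar>"]
    by (intro exI[of _ "arg_min_on (\<lambda>k. \<bar>server S k - r\<bar>) {..<card S}"]) auto
  from someI_ex[OF this] show "nearest S r < card S"
    "j < card S \<Longrightarrow> \<bar>server S (nearest S r) - r\<bar> \<le> \<bar>server S j - r\<bar>"
    unfolding nearest_def by auto
qed

lemma server_bij: "finite S \<Longrightarrow> bij_betw (server S) {..<card S} S"
  unfolding server_def
  using bij_betw_nth[of "sorted_list_of_set S" "{..<card S}" S] by simp

lemma server_mono: "finite S \<Longrightarrow> Suc k < card S \<Longrightarrow> server S k \<le> server S (Suc k)"
  unfolding server_def by (intro sorted_nth_mono) auto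

text \<open>Pairs of rounded request and chosen server, newest first. Earlier choices are recomputed
  from the history, since an online algorithm carries no state.\<close>

primrec robust_pairs :: "real set \<Rightarrow> (real \<times> real set) list \<Rightarrow> (nat \<times> nat) list" where
  "robust_pairs S [] = []"
| "robust_pairs S (e # h) =
    (nearest S (fst e),
     robust_choice (server S) (card S) (snd ` set (robust_pairs S h))
       (\<lambda>k. \<Sum>(q, c)\<leftarrow>robust_pairs S h. of_bool (c \<le> k) - of_bool (q \<le> k)) (nearest S (fst e)))
    # robust_pairs S h"

definition robust_config :: config_rule where
  "robust_config S h = server S ` snd ` set (robust_pairs S h)"

primrec predicted_config :: config_rule where
  "predicted_config S [] = {}"
| "predicted_config S (e # h) = snd e"

text \<open>\<open>follow\<close> expects the newest round first, and the head of its result is the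
  newest choice.\<close>

definition algorithm :: online_alg where
  "algorithm S h = hd (follow (combine robust_config predicted_config) S (rev h))"

text \<open>Choices made for a prefix are never revised, so the separate calls yield a single
  run.\<close>

lemma follow_prefixes:
  "map (\<lambda>i. hd (follow K S (rev (take (Suc i) h)))) [0..<length h] = rev (follow K S (rev h))"
proof (induction h rule: rev_induct)
  case (snoc e h)
  have "map (\<lambda>i. hd (follow K S (rev (take (Suc i) (h @ [e]))))) [0..<length h] = rev (follow K S (rev h))"
    unfolding snoc.IH[symmetric] by (intro map_cong) auto
  then show ?case by simp
qed simp

lemma sum_list_map_rev: "(\<Sum>x\<leftarrow>rev xs. f x) = (\<Sum>x\<leftarrow>xs. f x :: 'a :: comm_monoid_add)"
  by (simp add: sum_list_rev flip: rev_map)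

lemma serving_cost_rev:
  assumes "length cs = length rs" "length Ps = length rs"
  shows "serving_cost (rev (zip rs Ps)) cs = matching_cost rs (rev cs)"
proof -
  have "zip (rev (zip rs Ps)) cs = rev (zip (zip rs Ps) (rev cs))"
    using zip_rev[of "zip rs Ps" "rev cs"] assms by simp
  then have "serving_cost (rev (zip rs Ps)) cs = (\<Sum>(e, c)\<leftarrow>zip (zip rs Ps) (rev cs). \<bar>fst e - c\<bar>)"
    by (simp only: serving_cost_def sum_list_map_rev)
  also have "\<dots> = (\<Sum>i<length rs. \<bar>rs ! i - rev cs ! i\<bar>)"
    using assms by (simp add: sum_list_sum_nth atLeast0LessThan)
  finally show ?thesis by (simp add: matching_cost_def abs_minus_commute)
qed

text \<open>In an optimal matching, \<open>r\<close> takes over the partner of \<open>x\<close>; the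
  detour through \<open>x\<close> costs the extra term.\<close>

lemma serve_cost_insert_le:
  assumes "finite B" "x \<notin> B" "card A = Suc (card B)"
  shows "serve_cost B r A \<le> \<bar>r - x\<bar> + matching_dist A (insert x B)"
proof -
  have fA: "finite A" using assms card.infinite by force
  obtain f where f: "bij_betw f (insert x B) A"
    "matching_dist (insert x B) A = (\<Sum>z\<in>insert x B. \<bar>z - f z\<bar>)"
    using matching_dist_attained[of "insert x B" A] assms fA by auto
  have "bij_betw f B (A - {f x})"
    using bij_betw_DiffI[OF f(1), of "{x}" "{f x}"] bij_betw_apply[OF f(1), of x] assms(2) by simp
  then have "matching_dist B (A - {f x}) \<le> (\<Sum>z\<in>B. \<bar>z - f z\<bar>)"
    using assms by (intro matching_dist_le)
  moreover have "f x \<in> A" using f(1) by (auto simp: bij_betw_def)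
  ultimately have "serve_cost B r A \<le> \<bar>r - f x\<bar> + (\<Sum>z\<in>B. \<bar>z - f z\<bar>)"
    using serve_cost_le[OF fA, of "f x" B r] by simp
  also have "\<dots> \<le> \<bar>r - x\<bar> + matching_dist (insert x B) A"
    using f(2) assms by simp
  also have "matching_dist (insert x B) A \<le> matching_dist A (insert x B)"
    using assms fA by (intro matching_dist_commute_le) auto
  finally show ?thesis by simp
qed

section \<open>Analysis on a fixed input\<close>

locale input =
  fixes S :: "real set" and rs :: "real list" and Ps :: "real set list"
  assumes requests: "valid_requests S rs" and predictions: "valid_predictions S Ps"
begin

abbreviation "n \<equiv> card S"

definition hist :: "nat \<Rightarrow> (real \<times> real set) list" where
  "hist i = rev (take i (zip rs Ps))"

lemma finite_S: "finite S" and length_rs: "length rs = n" and length_Ps: "length Ps = n"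
  using requests predictions by (auto simp: valid_requests_def valid_predictions_def)

lemma hist_0: "hist 0 = []"
  by (simp add: hist_def)

lemma hist_Suc: "i < n \<Longrightarrow> hist (Suc i) = (rs ! i, Ps ! i) # hist i"
  using length_rs length_Ps by (simp add: hist_def take_Suc_conv_app_nth)

lemma hist_n: "hist n = rev (zip rs Ps)"
  using length_rs length_Ps by (simp add: hist_def)

lemma length_hist: "i \<le> n \<Longrightarrow> length (hist i) = i"
  using length_rs length_Ps by (simp add: hist_def)

lemma legalI:
  assumes "\<And>i. i \<le> n \<Longrightarrow> K S (hist i) \<subseteq> S \<and> card (K S (hist i)) = i" "i \<le> n"
  shows "legal K S (hist i)"
  using assms(2)
proof (induction i)
  case 0
  then show ?case using assms(1)[of 0] by (simp add: legal_def hist_0)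
next
  case (Suc i)
  then show ?case using assms(1)[of "Suc i"] by (simp add: hist_Suc legal_Cons length_hist)
qed

definition req :: "nat \<Rightarrow> nat" where
  "req i = nearest S (rs ! i)"

definition srv :: "nat \<Rightarrow> nat" where
  "srv i = snd (hd (robust_pairs S (hist (Suc i))))"

lemma robust_pairs_hist:
  "i \<le> n \<Longrightarrow> robust_pairs S (hist i) = rev (map (\<lambda>l. (req l, srv l)) [0..<i])"
  by (induction i) (simp_all add: hist_0 hist_Suc req_def srv_def)

sublocale robust_run "server S" n req srv
proof
  show "Suc k < n \<Longrightarrow> server S k \<le> server S (Suc k)" for k
    using server_mono finite_S .
  show "req i < n" if "i < n" for i
    unfolding req_def using that by (intro nearest) auto
  show "srv i = robust_choice (server S) n (srv ` {..<i}) (disc srv req i) (req i)" if i: "i < n" for i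
  proof -
    have pairs: "robust_pairs S (hist i) = rev (map (\<lambda>l. (req l, srv l)) [0..<i])"
      using i by (intro robust_pairs_hist) auto
    have "snd ` set (robust_pairs S (hist i)) = srv ` {..<i}"
      unfolding pairs by (auto simp: image_image atLeast0LessThan)
    moreover have "(\<Sum>(q, c)\<leftarrow>robust_pairs S (hist i). of_bool (c \<le> k) - of_bool (q \<le> k)) = disc srv req i k" for k
      unfolding pairs disc_def cnt_def sum_subtractf[symmetric]
      by (simp add: sum_list_map_rev o_def interv_sum_list_conv_sum_set_nat atLeast0LessThan del: sum_subtractf)
    ultimately show ?thesis
      using i unfolding srv_def[of i] by (simp add: hist_Suc req_def)
  qed
qed

lemma robust_config_hist: "i \<le> n \<Longrightarrow> robust_config S (hist i) = server S ` srv ` {..<i}"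
  by (auto simp: robust_config_def robust_pairs_hist image_image)

lemma inj_server: "inj_on (server S) {..<n}"
  using server_bij[OF finite_S] by (simp add: bij_betw_def)

lemma legal_robust: "legal robust_config S (hist n)"
proof (rule legalI)
  fix i assume i: "i \<le> n"
  have sub: "srv ` {..<i} \<subseteq> {..<n}" using c_less i by auto
  then have "card (server S ` srv ` {..<i}) = card (srv ` {..<i})"
    using inj_server by (intro card_image inj_on_subset[OF inj_server])
  also have "\<dots> = i" using inj_c[OF i] by (simp add: card_image)
  finally show "robust_config S (hist i) \<subseteq> S \<and> card (robust_config S (hist i)) = i"
    using sub server_bij[OF finite_S] i by (auto simp: robust_config_hist bij_betw_def)
qed simp

lemma predicted_config_hist:
  "i \<le> n \<Longrightarrow> predicted_config S (hist i) \<subseteq> S \<and> card (predicted_config S (hist i)) = i"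
  using predictions by (cases i) (auto simp: hist_0 hist_Suc valid_predictions_def)

lemma legal_predicted: "legal predicted_config S (hist n)"
  using predicted_config_hist by (rule legalI) simp_all

text \<open>These configurations are nested: the new server serves the request and all others stay
  in place.\<close>

lemma robust_config_cost:
  "i \<le> n \<Longrightarrow> config_cost robust_config S (hist i) \<le> (\<Sum>l<i. \<bar>rs ! l - server S (srv l)\<bar>)"
proof (induction i)
  case (Suc i)
  let ?X = "robust_config S (hist i)" and ?x = "server S (srv i)"
  have X: "?X = server S ` srv ` {..<i}" "robust_config S (hist (Suc i)) = insert ?x ?X"
    using Suc.prems by (auto simp: robust_config_hist lessThan_Suc)
  have "srv ` {..<i} \<subseteq> {..<n}" "srv i < n" "srv i \<notin> srv ` {..<i}"
    using c_less c_fresh[of i] Suc.prems by auto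
  then have "?x \<notin> ?X" unfolding X(1) using inj_server by (auto simp: inj_on_def)
  then have "serve_cost ?X (rs ! i) (insert ?x ?X) \<le> \<bar>rs ! i - ?x\<bar>"
    using serve_cost_le[of "insert ?x ?X" ?x ?X "rs ! i"] matching_dist_self_le[of ?X] X(1) by simp
  then show ?case using Suc X(2) by (simp add: hist_Suc)
qed (simp add: hist_0)

context
  fixes ms :: "real list"
  assumes ms: "perfect_matching S ms"
begin

lemma length_ms: "length ms = n"
  using ms distinct_card[of ms] by (simp add: perfect_matching_def)

lemma matching_cost_nonneg: "0 \<le> matching_cost rs ms"
  by (auto simp: matching_cost_def intro!: sum_nonneg)

text \<open>Rounding moves a request by at most its offline cost. So the offline matching costs at
  most twice as much on the rounded requests, and one more offline cost pays for returning to the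
  original ones.\<close>

lemma robust_competitive:
  assumes "2 \<le> n"
  shows "config_cost robust_config S (hist n) \<le> 9218 * ln (real n) * matching_cost rs ms"
proof -
  let ?off = "matching_cost rs ms"
  define p where "p i = inv_into {..<n} (server S) (ms ! i)" for i
  have in_S: "ms ! i \<in> server S ` {..<n}" if "i < n" for i
    using that length_ms ms server_bij[OF finite_S] nth_mem[of i ms]
    by (auto simp: perfect_matching_def bij_betw_def)
  have p: "server S (p i) = ms ! i" "p i < n" if "i < n" for i
    unfolding p_def using f_inv_into_f[OF in_S[OF that]] inv_into_into[OF in_S[OF that]] by auto
  have "inj_on p {..<n}"
  proof (rule inj_onI)
    fix i j assume ij: "i \<in> {..<n}" "j \<in> {..<n}" "p i = p j"
    then have "ms ! i = ms ! j" using p(1)[of i] p(1)[of j] by simp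
    then show "i = j" using ij ms length_ms by (simp add: perfect_matching_def nth_eq_iff_index_eq)
  qed
  from run_cost[OF this p(2)] assms
  have run: "(\<Sum>i<n. \<bar>server S (srv i) - server S (req i)\<bar>)
      \<le> 1536 * (1 + ln (real n)) * (\<Sum>i<n. \<bar>server S (p i) - server S (req i)\<bar>)"
    by simp
  have off: "?off = (\<Sum>i<n. \<bar>ms ! i - rs ! i\<bar>)" by (simp add: matching_cost_def length_rs)
  have near: "\<bar>server S (req i) - rs ! i\<bar> \<le> \<bar>ms ! i - rs ! i\<bar>" if "i < n" for i
    using nearest(2)[of S "p i" "rs ! i"] p[OF that] assms by (simp add: req_def)
  have "(\<Sum>i<n. \<bar>server S (p i) - server S (req i)\<bar>) \<le> (\<Sum>i<n. 2 * \<bar>ms ! i - rs ! i\<bar>)"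
  proof (intro sum_mono)
    fix i assume "i \<in> {..<n}"
    then have "i < n" by simp
    from near[OF this]
    show "\<bar>server S (p i) - server S (req i)\<bar> \<le> 2 * \<bar>ms ! i - rs ! i\<bar>"
      unfolding p(1)[OF \<open>i < n\<close>]
      using abs_triangle_ineq4[of "ms ! i - rs ! i" "server S (req i) - rs ! i"] by simp
  qed
  also have "\<dots> = 2 * ?off" by (simp add: off sum_distrib_left)
  finally have "1536 * (1 + ln (real n)) * (\<Sum>i<n. \<bar>server S (p i) - server S (req i)\<bar>)
      \<le> 1536 * (1 + ln (real n)) * (2 * ?off)"
    using assms by (intro mult_left_mono) auto
  note run = order_trans[OF run this]
  have "config_cost robust_config S (hist n) \<le> (\<Sum>i<n. \<bar>rs ! i - server S (srv i)\<bar>)"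
    by (rule robust_config_cost) simp
  also have "\<dots> \<le> (\<Sum>i<n. \<bar>server S (srv i) - server S (req i)\<bar> + \<bar>ms ! i - rs ! i\<bar>)"
  proof (intro sum_mono)
    fix i assume "i \<in> {..<n}"
    then show "\<bar>rs ! i - server S (srv i)\<bar> \<le> \<bar>server S (srv i) - server S (req i)\<bar> + \<bar>ms ! i - rs ! i\<bar>"
      using near[of i] by auto
  qed
  also have "\<dots> \<le> 1536 * (1 + ln (real n)) * (2 * ?off) + ?off"
    using run by (simp add: sum.distrib off)
  also have "\<dots> = (3073 + 3072 * ln (real n)) * ?off" by (simp add: algebra_simps)
  also have "\<dots> \<le> 9218 * ln (real n) * ?off"
  proof (intro mult_right_mono matching_cost_nonneg)
    \<comment> \<open>As \<open>ln n\<close> is at least 1 / 2, the additive constant is absorbed: 2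
      * 3073 + 3072 = 9218.\<close>
    have "ln (1 / 2 :: real) \<le> 1 / 2 - 1" by (intro ln_le_minus_one) auto
    then have "1 / 2 \<le> ln (2 :: real)" by (simp add: ln_div)
    also have "ln 2 \<le> ln (real n)" using assms by simp
    finally show "3073 + 3072 * ln (real n) \<le> 9218 * ln (real n)" by simp
  qed
  finally show ?thesis .
qed

text \<open>In each round, move to the offline configuration, serve with the offline server and move
  on to the new prediction. Each distance between a prediction and the offline configuration is paid
  at most twice: on arrival, and in advance for leaving.\<close>

lemma prediction_competitive:
  "config_cost predicted_config S (hist n) \<le> matching_cost rs ms + 2 * prediction_error Ps ms"
proof -
  let ?P = "\<lambda>i. predicted_config S (hist i)" and ?O = "configuration ms"
  have P: "finite (?P i)" "card (?P i) = i" if "i \<le> n" for i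
    using predicted_config_hist[OF that] finite_S by (auto dest: finite_subset)
  have O: "finite (?O i)" "card (?O i) = i" if "i \<le> n" for i
    using that ms length_ms by (auto simp: configuration_def perfect_matching_def distinct_card)
  have "config_cost predicted_config S (hist i) + matching_dist (?P i) (?O i) \<le>
      (\<Sum>l<i. \<bar>ms ! l - rs ! l\<bar> + 2 * matching_dist (?P (Suc l)) (?O (Suc l)))" if "i \<le> n" for i
    using that
  proof (induction i)
    case 0
    then show ?case using matching_dist_self_le[of "{}"] by (simp add: hist_0 configuration_def)
  next
    case (Suc i)
    then have i: "i \<le> n" "i < length ms" by (simp_all add: length_ms)
    have Oi: "?O (Suc i) = insert (ms ! i) (?O i)"
      using i by (auto simp: configuration_def take_Suc_conv_app_nth)
    have "ms ! i \<notin> ?O i"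
      using O(2)[OF Suc.prems] O[OF i(1)] unfolding Oi by (metis insert_absorb n_not_Suc_n)
    then have "serve_cost (?O i) (rs ! i) (?P (Suc i)) \<le> \<bar>rs ! i - ms ! i\<bar> + matching_dist (?P (Suc i)) (?O (Suc i))"
      unfolding Oi using P[OF Suc.prems] O[OF i(1)] by (intro serve_cost_insert_le) auto
    moreover have "serve_cost (?P i) (rs ! i) (?P (Suc i)) \<le>
        matching_dist (?P i) (?O i) + serve_cost (?O i) (rs ! i) (?P (Suc i))"
      using P[OF Suc.prems] P[OF i(1)] O[OF i(1)] by (intro serve_cost_triangle) auto
    ultimately show ?case using Suc by (simp add: hist_Suc abs_minus_commute)
  qed
  from this[of n]
  have "config_cost predicted_config S (hist n) + matching_dist (?P n) (?O n) \<le>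
      (\<Sum>l<n. \<bar>ms ! l - rs ! l\<bar>) + 2 * (\<Sum>l<n. matching_dist (?P (Suc l)) (?O (Suc l)))"
    by (simp add: sum.distrib sum_distrib_left)
  moreover have "0 \<le> matching_dist (?P n) (?O n)"
    using P[of n] O[of n] by (intro matching_dist_nonneg) auto
  moreover have "(\<Sum>l<n. matching_dist (?P (Suc l)) (?O (Suc l))) = prediction_error Ps ms"
    unfolding prediction_error_def length_Ps by (intro sum.cong) (auto simp: hist_Suc)
  ultimately show ?thesis by (simp add: matching_cost_def length_rs)
qed

end

lemma online_matching_algorithm:
  "online_matching algorithm S rs Ps = rev (follow (combine robust_config predicted_config) S (hist n))"
  using follow_prefixes[of "combine robust_config predicted_config" S "zip rs Ps"]
  by (simp add: online_matching_def algorithm_def hist_n length_rs length_Ps)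

lemma algorithm_perfect: "perfect_matching S (online_matching algorithm S rs Ps)"
  and algorithm_cost: "matching_cost rs (online_matching algorithm S rs Ps)
    \<le> 9 * min (config_cost robust_config S (hist n)) (config_cost predicted_config S (hist n))"
proof -
  let ?K = "combine robust_config predicted_config"
  let ?cs = "follow ?K S (hist n)"
  have legal: "legal ?K S (hist n)"
    using legal_robust legal_predicted by (rule legal_combine)
  have cs: "distinct ?cs" "set ?cs \<subseteq> S" "length ?cs = n"
    "serving_cost (hist n) ?cs + matching_dist (set ?cs) (?K S (hist n)) \<le> config_cost ?K S (hist n)"
    using follow_cost[OF finite_S legal] by (auto simp: length_hist)
  have "set ?cs = S"
    using cs finite_S by (intro card_subset_eq) (auto simp: distinct_card)
  then show "perfect_matching S (online_matching algorithm S rs Ps)"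
    using cs by (simp add: perfect_matching_def online_matching_algorithm)
  have "0 \<le> matching_dist (set ?cs) (?K S (hist n))"
    using legalD[OF legal] cs finite_S
    by (intro matching_dist_nonneg) (auto simp: distinct_card length_hist dest: finite_subset)
  then have "serving_cost (hist n) ?cs \<le> config_cost ?K S (hist n)" using cs by simp
  also have "\<dots> \<le> 9 * min (config_cost robust_config S (hist n)) (config_cost predicted_config S (hist n))"
    using finite_S legal_robust legal_predicted by (rule combine_cost)
  finally show "matching_cost rs (online_matching algorithm S rs Ps)
    \<le> 9 * min (config_cost robust_config S (hist n)) (config_cost predicted_config S (hist n))"
    using serving_cost_rev[of ?cs rs Ps] cs by (simp add: online_matching_algorithm hist_n length_rs length_Ps)
qed

end

theorem theorem4:
  shows "\<exists>A :: online_alg. online_algorithm A \<and>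
    (\<exists>(C :: real) (c :: real). C > 0 \<and>
      (\<forall>Off :: offline_alg. offline_algorithm Off \<longrightarrow>
        (\<forall>S rs Ps. valid_requests S rs \<and> valid_predictions S Ps \<and> card S \<ge> 2 \<longrightarrow>
          (let off = matching_cost rs (Off S rs);
               \<eta> = prediction_error Ps (Off S rs)
           in matching_cost rs (online_matching A S rs Ps)
                \<le> C * min (ln (real (card S))) (1 + \<eta> / off) * off + c))))"
proof (rule exI[of _ algorithm], rule conjI, goal_cases)
  case 1
  show "online_algorithm algorithm"
    unfolding online_algorithm_def using input.algorithm_perfect by (auto simp: input_def)
next
  case 2
  show ?case
  \<comment> \<open>The factor is 9 * 9218, from \<open>algorithm_cost\<close> and
    \<open>robust_competitive\<close>; it also covers the factor 18 of the prediction error.\<close>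
  proof (rule exI[of _ 82962], rule exI[of _ 0], intro conjI allI impI)
    fix Off :: offline_alg and S rs Ps
    assume Off: "offline_algorithm Off"
      and valid: "valid_requests S rs \<and> valid_predictions S Ps \<and> card S \<ge> 2"
    then interpret input S rs Ps by unfold_locales auto
    define off where "off = matching_cost rs (Off S rs)"
    define \<eta> where "\<eta> = prediction_error Ps (Off S rs)"
    define alg where "alg = matching_cost rs (online_matching algorithm S rs Ps)"
    have ms: "perfect_matching S (Off S rs)" using Off valid by (simp add: offline_algorithm_def)
    have off: "0 \<le> off" unfolding off_def by (rule matching_cost_nonneg[OF ms])
    have \<eta>: "0 \<le> \<eta>"
      unfolding \<eta>_def prediction_error_def
    proof (intro sum_nonneg matching_dist_nonneg)
      fix i assume "i \<in> {..<length Ps}"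
      then have i: "i < card S" by (simp add: length_Ps)
      show "finite (Ps ! i)" "finite (configuration (Off S rs) (Suc i))"
        using predictions i finite_S by (auto simp: valid_predictions_def configuration_def dest: finite_subset)
      show "card (Ps ! i) = card (configuration (Off S rs) (Suc i))"
        using predictions i ms length_ms[OF ms]
        by (simp add: valid_predictions_def configuration_def perfect_matching_def distinct_card)
    qed
    have robust: "alg \<le> 82962 * (ln (real (card S)) * off)"
      using algorithm_cost robust_competitive[OF ms] valid unfolding alg_def off_def by simp
    have predicted: "alg \<le> 82962 * (off + \<eta>)"
      using algorithm_cost prediction_competitive[OF ms] off \<eta> unfolding alg_def off_def \<eta>_def by simp
    have "alg \<le> 82962 * min (ln (real (card S))) (1 + \<eta> / off) * off"
    proof (cases "off = 0")
      \<comment> \<open>Division by zero makes \<open>\<eta> / off\<close> equal to 0. The claimed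
        bound is then 0, and the robust bound already gives it.\<close>
      case True
      then show ?thesis using robust by simp
    next
      case False
      then have "(1 + \<eta> / off) * off = off + \<eta>" by (simp add: field_simps)
      then have "min (ln (real (card S))) (1 + \<eta> / off) * off = min (ln (real (card S)) * off) (off + \<eta>)"
        using off by (simp add: min_mult_distrib_right)
      then show ?thesis using robust predicted by (simp add: mult.assoc min_def)
    qed
    then show "let off = matching_cost rs (Off S rs); \<eta> = prediction_error Ps (Off S rs)
      in matching_cost rs (online_matching algorithm S rs Ps)
        \<le> 82962 * min (ln (real (card S))) (1 + \<eta> / off) * off + 0"
      by (simp add: Let_def off_def \<eta>_def alg_def)
  qed simp
qed

end
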